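(* Let $Z^\star\in\mathbb{R}^{d_1\times d_2}$ have rank $r^\star\le r$. Suppose the linear map $\mathcal{A}:\mathbb{R}^{d_1\times d_2}\to\mathbb{R}^m$ satisfies, for some $\delta\in(0,1)$, $(1-\delta)\|Z\|_F^2\le\|\mathcal{A}(Z)\|_2^2\le(1+\delta)\|Z\|_F^2$ for all $Z$ of rank at most $6r$, and let $b=\mathcal{A}(Z^\star)$. Let $X^\star(Y^\star)^\top=Z^\star$, $X^\star\in\mathbb{R}^{d_1\times r}$, $Y^\star\in\mathbb{R}^{d_2\times r}$, be a factorization with $\operatorname{rank}(X^\star)=\operatorname{rank}(Y^\star)=r^\star$ and matching right singular vectors $V^{X^\star}=V^{Y^\star}$. Apply the LMM method with $F(X,Y)=XY^\top$ and $h(Z)=\|\mathcal{A}(Z)-b\|_2^2$, initialized at $(X_0,Y_0)\in\mathbb{R}^{d_1\times r}\times\mathbb{R}^{d_2\times r}$ and with the Polyak configuration with parameters $\gamma,C_{\mathtt{lb}},C_{\mathtt{ub}}$ satisfying $\gamma\le\min\left\{1,\frac{C_{\mathtt{lb}}}{\sqrt2}\right\}$ and $$C_{\mathtt{ub}}\le\frac{1}{2^9\cdot5\sqrt2\,(r-r^\star+1)^2}\frac{(1-\delta)^4}{(1+\delta)^4}\frac{\min\{\sigma_{r^\star}^2(X^\star),\sigma_{r^\star}^2(Y^\star)\}}{\sigma_{r^\star}^2(X^\star)+\sigma_{r^\star}^2(Y^\star)},$$ and suppose $$\|(X_0,Y_0)-(X^\star,Y^\star)\|_F\le\frac{1}{32\sqrt2}\frac{\min\{\sigma_{r^\star}^2(X^\star),\sigma_{r^\star}^2(Y^\star)\}}{\max\{\sigma_1(X^\star),\sigma_1(Y^\star)\}},$$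 $$\|X_0Y_0^\top-Z^\star\|_F\le\frac{1}{2^{23}}\frac{(1-\delta)^4}{(1+\delta)^4}\frac{\min\{\sigma_{r^\star}^4(X^\star),\sigma_{r^\star}^4(Y^\star)\}}{\min\{\sigma_1^2(X^\star),\sigma_1^2(Y^\star)\}}C_{\mathtt{lb}}.$$ Then the iterates satisfy $$\|X_kY_k^\top-Z^\star\|_F^2\le\left(1-\frac{\gamma}{32}\frac{(1-\delta)^2}{(1+\delta)^2}\right)^k\|X_0Y_0^\top-Z^\star\|_F^2\quad\text{for all }k\ge0.$$
   Context: Matrix spaces carry the trace inner product and Frobenius norm; $\|(X,Y)\|_F^2=\|X\|_F^2+\|Y\|_F^2$. $\sigma_i(\cdot)$ is the $i$-th largest singular value. $V^{X^\star}=V^{Y^\star}$ means that $X^\star$ and $Y^\star$ admit (full) singular value decompositions $X^\star=U^{X^\star}\Sigma^{X^\star}V^\top$, $Y^\star=U^{Y^\star}\Sigma^{Y^\star}V^\top$ (singular values nonincreasing) with the same orthogonal $V\in\mathbb{R}^{r\times r}$. LMM (Levenberg-Morrison-Marquardt) method for $f=h\circ F$, $F:\mathbf{E}\to\mathbf{Y}$. Given $x_0$, stepsizes $\gamma_k>0$ and damping coefficients $\lambda_k>0$: for $k\ge0$ let $v_k=\nabla h(F(x_k))$ and set $x_{k+1}=x_k-\gamma_k(\nabla F(x_k)^\top\nabla F(x_k)+\lambda_kI)^{-1}\nabla F(x_k)^\top v_k$, where $\nabla F(x)$ is the derivative (a linear map) and $\nabla F(x)^\top$ its adjoint. Here $x_k=(X_k,Y_k)$.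 Write $z_k=F(x_k)$; let $h^\star$, $\mathcal{Z}^\star$ be the minimum value and set of minimizers of $h$ over $\operatorname{Im}F$, and $\Pi^x$ the orthogonal projection onto the range of $\nabla F(x)$. Polyak configuration with parameters $\gamma>0$, $0<C_{\mathtt{lb}}\le C_{\mathtt{ub}}$: $\gamma_k=\gamma\frac{h(z_k)-h^\star}{\|\Pi^{x_k}v_k\|^2}$ and $C_{\mathtt{lb}}\operatorname{dist}(z_k,\mathcal{Z}^\star)\le\lambda_k\le C_{\mathtt{ub}}\operatorname{dist}(z_k,\mathcal{Z}^\star)$ for all $k$. *)

theory Defs
  imports "HOL-Analysis.Analysis"
begin

(* Matrices are elements of real^'n^'m (m rows, n columns); the library inner product and norm
   on this type are the trace inner product and the Frobenius norm, and the norm of a pair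
   satisfies norm (X, Y) ^ 2 = norm X ^ 2 + norm Y ^ 2. *)

(* Finite index types carry no order, so the diagonal of a rectangular matrix is read off along
   a fixed enumeration of the row and of the column indices with positions 1, ..., CARD. *)
definition pos :: "'n::finite \<Rightarrow> nat" where
  "pos i = Suc (to_nat_on UNIV i)"

definition is_svd :: "real^'n^'m \<Rightarrow> real^'m^'m \<Rightarrow> real^'n^'m \<Rightarrow> real^'n^'n \<Rightarrow> bool" where
  "is_svd A U S V \<longleftrightarrow>
     orthogonal_matrix U \<and> orthogonal_matrix V \<and> A = U ** S ** transpose V \<and>
     (\<forall>i j. pos i \<noteq> pos j \<longrightarrow> S $ i $ j = 0) \<and>
     (\<forall>i j. pos i = pos j \<longrightarrow> 0 \<le> S $ i $ j) \<and>
     (\<forall>i j i' j'. pos i = pos j \<longrightarrow> pos i' = pos j' \<longrightarrow> pos i \<le> pos i' \<longrightarrow>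
        S $ i' $ j' \<le> S $ i $ j)"

(* The k-th largest singular value, 1 <= k <= min m n: the k-th diagonal entry of the middle
   factor of any full singular value decomposition (it does not depend on the choice).
   Unspecified for other k. *)
definition singular_value :: "real^'n^'m \<Rightarrow> nat \<Rightarrow> real" where
  "singular_value A k =
     (THE s. \<exists>U S V i j. is_svd A U S V \<and> pos i = k \<and> pos j = k \<and> s = S $ i $ j)"

definition same_right_singular_vectors :: "real^'r^'m \<Rightarrow> real^'r^'n \<Rightarrow> bool" where
  "same_right_singular_vectors X Y \<longleftrightarrow>
     (\<exists>U S U' S' V. is_svd X U S V \<and> is_svd Y U' S' V)"

definition gradient :: "('a::real_inner \<Rightarrow> real) \<Rightarrow> 'a \<Rightarrow> 'a" where
  "gradient h z = (THE v. GDERIV h z :> v)"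

abbreviation derivative ::
    "('a::real_normed_vector \<Rightarrow> 'b::real_normed_vector) \<Rightarrow> 'a \<Rightarrow> 'a \<Rightarrow> 'b" where
  "derivative F x \<equiv> frechet_derivative F (at x)"

definition opt_value :: "('b \<Rightarrow> real) \<Rightarrow> ('a \<Rightarrow> 'b) \<Rightarrow> real" where
  "opt_value h F = (INF z\<in>range F. h z)"

definition opt_set :: "('b \<Rightarrow> real) \<Rightarrow> ('a \<Rightarrow> 'b) \<Rightarrow> 'b set" where
  "opt_set h F = {z \<in> range F. \<forall>w\<in>range F. h z \<le> h w}"

(* closest_point onto a linear subspace is the orthogonal projection onto it. *)
definition range_projection ::
    "('a::euclidean_space \<Rightarrow> 'b::euclidean_space) \<Rightarrow> 'a \<Rightarrow> 'b \<Rightarrow> 'b" where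
  "range_projection F x = closest_point (range (derivative F x))"

definition lmm_step ::
    "('b::euclidean_space \<Rightarrow> real) \<Rightarrow> ('a::euclidean_space \<Rightarrow> 'b) \<Rightarrow> real \<Rightarrow> real \<Rightarrow> 'a \<Rightarrow> 'a" where
  "lmm_step h F g l x =
     x - g *\<^sub>R inv (\<lambda>u. adjoint (derivative F x) (derivative F x u) + l *\<^sub>R u)
                (adjoint (derivative F x) (gradient h (F x)))"

(* At an optimal F (x k) the Polyak configuration below forces the damping to be 0 and its
   stepsize reads 0 / 0: the method has terminated, and the sequence is continued constantly.
   At every other iterate the stepsize and the damping must be positive. *)
definition lmm_sequence ::
    "('b::euclidean_space \<Rightarrow> real) \<Rightarrow> ('a::euclidean_space \<Rightarrow> 'b) \<Rightarrow>
     (nat \<Rightarrow> real) \<Rightarrow> (nat \<Rightarrow> real) \<Rightarrow> (nat \<Rightarrow> 'a) \<Rightarrow> bool" where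
  "lmm_sequence h F gam lam x \<longleftrightarrow>
     (\<forall>k. if F (x k) \<in> opt_set h F then x (Suc k) = x k
          else 0 < gam k \<and> 0 < lam k \<and> x (Suc k) = lmm_step h F (gam k) (lam k) (x k))"

definition polyak_configuration ::
    "('b::euclidean_space \<Rightarrow> real) \<Rightarrow> ('a::euclidean_space \<Rightarrow> 'b) \<Rightarrow> real \<Rightarrow> real \<Rightarrow> real \<Rightarrow>
     (nat \<Rightarrow> real) \<Rightarrow> (nat \<Rightarrow> real) \<Rightarrow> (nat \<Rightarrow> 'a) \<Rightarrow> bool" where
  "polyak_configuration h F g Clb Cub gam lam x \<longleftrightarrow>
     (\<forall>k. gam k = g * ((h (F (x k)) - opt_value h F) /
                       (norm (range_projection F (x k) (gradient h (F (x k)))))\<^sup>2) \<and>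
          Clb * infdist (F (x k)) (opt_set h F) \<le> lam k \<and>
          lam k \<le> Cub * infdist (F (x k)) (opt_set h F))"

end

theory Submission
  imports Defs
begin

text \<open>
  Write \<open>e = X Y\<^sup>T - Zs\<close> for the error at the current iterate, \<open>J\<close> for the derivative of \<open>F\<close> there, \<open>l\<close> for the
  damping, and \<open>v\<close> for the gradient of \<open>h\<close>. A step moves the product by \<open>- g P v\<close>, where \<open>P = J (J\<^sup>T J + l)\<^sup>-\<^sup>1 J\<^sup>T\<close>
  is a damped projection onto the range of \<open>J\<close>, plus a term quadratic in the step. Since \<open>\<langle>v, e\<rangle>\<close> is twice
  the function value, a Polyak step along \<open>v\<close> itself would contract the error. So the point is that little
  is lost by replacing \<open>v\<close> with \<open>P v\<close>, that is, that \<open>e - P e\<close> is small compared with \<open>e\<close>.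

  By the variational description of \<open>P\<close> (\<open>damped_solution_optimal\<close>) the squared norm of \<open>e - P e\<close> is at most
  \<open>|e - J u|\<^sup>2 + l |u|\<^sup>2\<close> for every \<open>u\<close>. As \<open>l\<close> is at most \<open>Cub |e|\<close>, it suffices to find \<open>u\<close> with residual
  quadratic in \<open>e\<close> and \<open>|u|\<^sup>2\<close> at most a multiple of \<open>|e|\<close>; this is \<open>tangent_approximation\<close>. On the
  span of the right singular vectors for nonzero singular values, which \<open>Xs\<close> and \<open>Ys\<close> share because these
  vectors match, the factors are well conditioned and \<open>u\<close> can even be taken of order \<open>|e|\<close>. In the remaining
  \<open>r - rs\<close> redundant directions the factors are arbitrarily ill conditioned, and \<open>u\<close> is built from a
  singular value decomposition of one factor by varying, for each singular vector, the smaller of the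
  two factors (\<open>splitting\<close>). This loses only the number of redundant directions.

  The quadratic term is harmless because \<open>l\<close> is at least \<open>Clb |e|\<close>: a damped solution is at most
  \<open>1 / (2 sqrt l)\<close> times as long as the projected gradient. These facts give a contraction of \<open>|e|\<^sup>2\<close> by the factor
  \<open>1 - \<gamma> \<rho> / 2\<close> with \<open>\<rho> = (1 - \<delta>) / (1 + \<delta>)\<close> (\<open>lmm_step_contracts\<close>), which is stronger than the claimed rate. The
  distance to \<open>(Xs, Ys)\<close> plus a multiple of \<open>sqrt |e|\<close> does not increase (\<open>potential_step\<close>), so the
  iterates stay in the region where the estimates hold.
\<close>

section \<open>Matrix algebra, spectral bounds and pseudoinverses\<close>

lemma matrix_diff_left: "A ** (B - C) = A ** B - A ** (C :: real^'k^'n)" for A :: "real^'n^'m"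
  by (vector matrix_matrix_mult_def sum_subtractf[symmetric] right_diff_distrib)

lemma matrix_diff_right: "(A - B) ** C = A ** C - B ** (C :: real^'k^'n)" for A :: "real^'n^'m"
  by (vector matrix_matrix_mult_def sum_subtractf[symmetric] left_diff_distrib)

lemma matrix_add_right: "(A + B) ** C = A ** C + B ** (C :: real^'k^'n)" for A :: "real^'n^'m"
  by (vector matrix_matrix_mult_def sum.distrib[symmetric] distrib_right)

lemma matrix_minus_left: "A ** (- B) = - (A ** (B :: real^'k^'n))" for A :: "real^'n^'m"
  by (vector matrix_matrix_mult_def sum_negf)

lemma matrix_minus_right: "(- A) ** B = - (A ** (B :: real^'k^'n))" for A :: "real^'n^'m"
  by (vector matrix_matrix_mult_def sum_negf)

lemma matrix_zero_left [simp]: "A ** (0 :: real^'k^'n) = 0" for A :: "real^'n^'m"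
  by (vector matrix_matrix_mult_def)

lemma matrix_zero_right [simp]: "(0 :: real^'n^'m) ** (A :: real^'k^'n) = 0"
  by (vector matrix_matrix_mult_def)

lemma matrix_scaleR_right: "(c *\<^sub>R A) ** B = c *\<^sub>R (A ** (B :: real^'k^'n))" for A :: "real^'n^'m"
  by (vector matrix_matrix_mult_def sum_distrib_left mult.assoc)

lemma matrix_scaleR_left: "A ** (c *\<^sub>R B) = c *\<^sub>R (A ** (B :: real^'k^'n))" for A :: "real^'n^'m"
  by (vector matrix_matrix_mult_def sum_distrib_left mult.left_commute)

lemmas matrix_distribs = matrix_diff_left matrix_diff_right matrix_add_ldistrib matrix_add_right
  matrix_minus_left matrix_minus_right matrix_scaleR_right matrix_scaleR_left

lemma transpose_add: "transpose (A + B) = transpose A + transpose (B :: real^'n^'m)"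
  by (vector transpose_def)

lemma transpose_diff: "transpose (A - B) = transpose A - transpose (B :: real^'n^'m)"
  by (vector transpose_def)

lemma transpose_minus: "transpose (- A) = - transpose (A :: real^'n^'m)"
  by (vector transpose_def)

lemma transpose_zero [simp]: "transpose (0 :: real^'n^'m) = 0"
  by (vector transpose_def)

lemmas transpose_distribs = transpose_add transpose_diff transpose_minus transpose_scalar
  matrix_transpose_mul

lemma norm_transpose [simp]: "norm (transpose A) = norm (A :: real^'n^'m)"
proof -
  have "(norm (transpose A))\<^sup>2 = (norm A)\<^sup>2"
    by (simp add: power2_norm_eq_inner inner_vec_def transpose_def) (rule sum.swap)
  then show ?thesis by simp
qed

lemma inner_matrix_vector: "inner (A *v a) b = inner a (transpose A *v b)" for A :: "real^'n^'m"
  using dot_lmul_matrix[of b A a] by (simp add: inner_commute)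

text \<open>A bound on the spectral norm. The Frobenius norm of a projection or of a pseudoinverse grows with
  its rank; working with spectral bounds on such factors keeps every constant free of \<open>r\<close>.\<close>

definition op_bound :: "real^'n^'m \<Rightarrow> real \<Rightarrow> bool" where
  "op_bound A c \<longleftrightarrow> 0 \<le> c \<and> (\<forall>a. norm (A *v a) \<le> c * norm a)"

lemma op_bound_transpose:
  assumes "op_bound A c" shows "op_bound (transpose A) c"
  unfolding op_bound_def
proof (intro conjI allI)
  show "0 \<le> c" using assms by (simp add: op_bound_def)
  fix a
  let ?b = "transpose A *v a"
  have "(norm ?b)\<^sup>2 = inner (A *v ?b) a"
    by (simp only: power2_norm_eq_inner inner_matrix_vector)
  also have "\<dots> \<le> norm (A *v ?b) * norm a" by (rule norm_cauchy_schwarz)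
  also have "\<dots> \<le> c * norm ?b * norm a"
    using assms by (intro mult_right_mono) (simp_all add: op_bound_def)
  finally have "norm ?b * norm ?b \<le> norm ?b * (c * norm a)"
    by (simp add: power2_eq_square mult.assoc mult.left_commute)
  then show "norm ?b \<le> c * norm a"
    using \<open>0 \<le> c\<close> by (cases "norm ?b = 0") (simp_all only: mult_le_cancel_left, auto)
qed

lemma norm_eq_columns: "(norm (A :: real^'n^'m))\<^sup>2 = (\<Sum>j\<in>UNIV. (norm (column j A))\<^sup>2)"
  by (simp add: power2_norm_eq_inner inner_vec_def column_def) (rule sum.swap)

lemma column_mult: "column j (A ** B) = A *v column j (B :: real^'k^'n)" for A :: "real^'n^'m"
  by (vector column_def matrix_matrix_mult_def matrix_vector_mult_def)

lemma norm_mult_left: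
  assumes "op_bound A c" shows "norm (A ** (B :: real^'k^'n)) \<le> c * norm B"
proof -
  have c: "0 \<le> c" using assms by (simp add: op_bound_def)
  have "(norm (A ** B))\<^sup>2 = (\<Sum>j\<in>UNIV. (norm (A *v column j B))\<^sup>2)"
    by (simp add: norm_eq_columns column_mult)
  also have "\<dots> \<le> (\<Sum>j\<in>UNIV. (c * norm (column j B))\<^sup>2)"
    using assms by (intro sum_mono power_mono) (auto simp: op_bound_def)
  also have "\<dots> = (c * norm B)\<^sup>2"
    by (simp add: power_mult_distrib norm_eq_columns[of B] sum_distrib_left)
  finally show ?thesis using c by (simp add: power2_le_iff_abs_le)
qed

lemma norm_mult_right:
  assumes "op_bound B c" shows "norm ((A :: real^'n^'m) ** B) \<le> norm A * c"
  using norm_mult_left[OF op_bound_transpose[OF assms], of "transpose A"]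
  by (metis matrix_transpose_mul mult.commute norm_transpose)

lemma op_bound_norm: "op_bound (A :: real^'n^'m) (norm A)"
  unfolding op_bound_def
proof (intro conjI allI)
  fix a
  have "(norm (A *v a))\<^sup>2 = (\<Sum>i\<in>UNIV. (inner (A $ i) a)\<^sup>2)"
    unfolding power2_norm_eq_inner inner_vec_def[of "A *v a"] matrix_vector_mul_component
    by (simp add: power2_eq_square)
  also have "\<dots> \<le> (\<Sum>i\<in>UNIV. (norm (A $ i))\<^sup>2 * (norm a)\<^sup>2)"
    by (intro sum_mono) (metis Cauchy_Schwarz_ineq power2_norm_eq_inner)
  also have "\<dots> = (norm A * norm a)\<^sup>2"
    by (simp add: power_mult_distrib power2_norm_eq_inner[of A] inner_vec_def[of A] power2_norm_eq_inner sum_distrib_right)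
  finally show "norm (A *v a) \<le> norm A * norm a"
    by (simp add: power2_le_iff_abs_le)
qed simp

lemma norm_mult_le: "norm ((A :: real^'n^'m) ** (B :: real^'k^'n)) \<le> norm A * norm B"
  by (rule norm_mult_left[OF op_bound_norm])

lemma op_bound_diff:
  assumes "op_bound A c" "op_bound B d" shows "op_bound (A - B) (c + d)"
  unfolding op_bound_def
proof (intro conjI allI)
  fix a
  have "norm ((A - B) *v a) \<le> norm (A *v a) + norm (B *v a)"
    by (simp add: matrix_vector_mult_diff_rdistrib norm_triangle_ineq4)
  also have "\<dots> \<le> c * norm a + d * norm a"
    using assms by (intro add_mono) (simp_all add: op_bound_def)
  finally show "norm ((A - B) *v a) \<le> (c + d) * norm a" by (simp add: distrib_right)
qed (use assms in \<open>simp add: op_bound_def\<close>)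

lemma op_bound_mat_1: "op_bound (mat 1) 1"
  by (simp add: op_bound_def)

lemma op_bound_mono: "op_bound A c \<Longrightarrow> c \<le> d \<Longrightarrow> op_bound A d"
  unfolding op_bound_def by (meson mult_right_mono norm_ge_zero order_trans)

definition orthogonal_projection :: "real^'n^'n \<Rightarrow> bool" where
  "orthogonal_projection P \<longleftrightarrow> transpose P = P \<and> P ** P = P"

lemma orthogonal_projection_bound:
  assumes "orthogonal_projection P" shows "op_bound P 1"
  unfolding op_bound_def
proof (intro conjI allI)
  fix a
  have "(norm (P *v a))\<^sup>2 = inner a (P *v a)"
    using assms by (metis inner_matrix_vector matrix_vector_mul_assoc orthogonal_projection_def power2_norm_eq_inner)
  also have "\<dots> \<le> norm a * norm (P *v a)" by (rule norm_cauchy_schwarz)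
  finally have "norm (P *v a) * norm (P *v a) \<le> norm a * norm (P *v a)"
    by (simp add: power2_eq_square)
  then show "norm (P *v a) \<le> 1 * norm a"
    by (cases "norm (P *v a) = 0") (simp_all only: mult_le_cancel_right, auto)
qed simp

lemma orthogonal_projection_compl:
  "orthogonal_projection P \<Longrightarrow> orthogonal_projection (mat 1 - P)"
  by (simp add: orthogonal_projection_def transpose_distribs matrix_distribs)

text \<open>The Moore-Penrose inverse from the normal equations. \<open>X\<^sup>T X\<close> is singular exactly on the kernel of
  \<open>p\<close>, so adding the complementary projection makes it invertible without changing it on the range of
  \<open>p\<close>. Then \<open>X ** G\<close> is the orthogonal projection onto the column space of \<open>X\<close>, and being a contraction
  it gives the bound on \<open>G\<close>.\<close>

lemma pseudoinverse_exists:
  fixes X :: "real^'r^'m"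
  assumes p: "orthogonal_projection p" and Xp: "X ** p = X"
    and lower: "\<And>a. \<mu> * norm (p *v a) \<le> norm (X *v a)" and \<mu>: "0 < \<mu>"
  obtains G where "G ** X = p" "p ** G = G" "orthogonal_projection (X ** G)" "op_bound G (1 / \<mu>)"
proof -
  define n where "n = mat 1 - p"
  have n: "orthogonal_projection n" using orthogonal_projection_compl[OF p] by (simp add: n_def)
  have Xn: "X ** n = 0" by (simp add: n_def matrix_distribs Xp)
  then have nX: "n ** transpose X = 0"
    by (metis matrix_transpose_mul n orthogonal_projection_def transpose_zero)
  define M where "M = transpose X ** X + n"
  have "a = 0" if "M *v a = 0" for a
  proof -
    have "inner a (M *v a) = (norm (X *v a))\<^sup>2 + (norm (n *v a))\<^sup>2"
    proof -
      have "inner a (n *v a) = (norm (n *v a))\<^sup>2"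
        using n by (metis inner_matrix_vector matrix_vector_mul_assoc orthogonal_projection_def power2_norm_eq_inner)
      moreover have "inner a ((transpose X ** X) *v a) = (norm (X *v a))\<^sup>2"
        by (metis inner_matrix_vector matrix_vector_mul_assoc power2_norm_eq_inner)
      ultimately show ?thesis by (simp add: M_def matrix_vector_mult_add_rdistrib inner_add_right)
    qed
    with that have "norm (X *v a) = 0" "norm (n *v a) = 0"
      by (auto simp: add_nonneg_eq_0_iff)
    with lower[of a] \<mu> have "p *v a = 0" "n *v a = 0" by (auto simp: mult_le_0_iff)
    then show "a = 0" by (simp add: n_def matrix_vector_mult_diff_rdistrib)
  qed
  then obtain M' where M': "M' ** M = mat 1"
    using matrix_left_invertible_ker[of M] by blast
  then have M'2: "M ** M' = mat 1" by (simp add: matrix_left_right_inverse)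
  have symM: "transpose M = M"
    using n by (simp add: M_def transpose_distribs orthogonal_projection_def)
  have symM': "transpose M' = M'"
    by (metis M' M'2 matrix_mul_assoc matrix_mul_lid matrix_mul_rid matrix_transpose_mul symM transpose_mat)
  have "M ** n = n"
    using n Xn by (simp add: M_def matrix_distribs orthogonal_projection_def matrix_mul_assoc[symmetric])
  then have M'n: "M' ** n = n" by (metis M' matrix_mul_assoc matrix_mul_lid)
  then have nM': "n ** M' = n"
    by (metis matrix_transpose_mul n orthogonal_projection_def symM')
  define G where "G = M' ** transpose X"
  have GX: "G ** X = p"
  proof -
    have "G ** X = M' ** (M - n)" by (simp add: G_def M_def matrix_mul_assoc)
    also have "\<dots> = p" by (simp add: matrix_distribs M' M'n) (simp add: n_def)
    finally show ?thesis .
  qed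
  have "n ** G = 0" by (simp add: G_def matrix_mul_assoc nM' nX)
  then have pG: "p ** G = G" by (simp add: n_def matrix_distribs)
  have XG: "orthogonal_projection (X ** G)"
    unfolding orthogonal_projection_def
  proof
    show "transpose (X ** G) = X ** G"
      by (simp add: G_def transpose_distribs symM' matrix_mul_assoc)
    show "X ** G ** (X ** G) = X ** G"
      by (metis GX Xp matrix_mul_assoc)
  qed
  have "op_bound G (1 / \<mu>)"
    unfolding op_bound_def
  proof (intro conjI allI)
    fix a
    have "\<mu> * norm (G *v a) \<le> norm (X *v (G *v a))"
      using lower[of "G *v a"] by (simp add: matrix_vector_mul_assoc pG)
    also have "\<dots> \<le> norm a"
      using orthogonal_projection_bound[OF XG] by (simp add: op_bound_def matrix_vector_mul_assoc)
    finally show "norm (G *v a) \<le> 1 / \<mu> * norm a" using \<mu> by (simp add: field_simps)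
  qed (use \<mu> in simp)
  with GX pG XG show thesis by (rule that)
qed

section \<open>Splitting a small product of redundant columns\<close>

text \<open>The right singular vectors of \<open>f\<close> restricted to \<open>H\<close>. A unit vector \<open>v\<close> at which \<open>norm (f v)\<close> is
  largest is a critical point, which makes \<open>f v\<close> orthogonal to the image of everything in \<open>H\<close> that is
  orthogonal to \<open>v\<close>; the rest of the basis comes from that smaller subspace.\<close>

lemma orthonormal_basis_with_orthogonal_images:
  fixes f :: "'a::euclidean_space \<Rightarrow> 'b::euclidean_space"
  assumes "linear f" "subspace H"
  shows "\<exists>B. B \<subseteq> H \<and> pairwise orthogonal B \<and> (\<forall>v\<in>B. norm v = 1) \<and> span B = H \<and>
    pairwise (\<lambda>v w. orthogonal (f v) (f w)) B"
  using assms(2)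
proof (induction "dim H" arbitrary: H rule: less_induct)
  case less
  show ?case
  proof (cases "H \<subseteq> {0}")
    case True
    then have "H = {0}" using less.prems subspace_0 by blast
    then show ?thesis by (intro exI[of _ "{}"]) (auto simp: pairwise_def)
  next
    case False
    then obtain h where h: "h \<in> H" "h \<noteq> 0" by auto
    let ?S = "H \<inter> sphere 0 1"
    have "h /\<^sub>R norm h \<in> ?S" using h less.prems by (simp add: subspace_mul)
    then have "?S \<noteq> {}" by blast
    moreover have "compact ?S"
      using closed_subspace[OF less.prems] by (simp add: closed_Int_compact)
    moreover have "continuous_on ?S (\<lambda>x. norm (f x))"
      using \<open>linear f\<close> by (intro continuous_on_norm linear_continuous_on linear_conv_bounded_linear[THEN iffD1])
    ultimately obtain v where v: "v \<in> ?S" and vmax: "\<And>x. x \<in> ?S \<Longrightarrow> norm (f x) \<le> norm (f v)"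
      using continuous_attains_sup[of ?S "\<lambda>x. norm (f x)"] by blast
    have vH: "v \<in> H" and nv: "norm v = 1" using v by auto
    have rayleigh: "norm (f x) \<le> norm (f v) * norm x" if "x \<in> H" for x
    proof (cases "x = 0")
      case False
      have "x /\<^sub>R norm x \<in> ?S" using that False less.prems by (simp add: subspace_mul)
      from vmax[OF this] have "norm (f x) / norm x \<le> norm (f v)"
        by (simp add: linear_scale[OF \<open>linear f\<close>] divide_inverse_commute)
      then show ?thesis using False by (simp add: field_simps)
    qed (simp add: linear_0[OF \<open>linear f\<close>])
    have crit: "inner (f v) (f w) = 0" if w: "w \<in> H" "inner v w = 0" for w
    proof -
      \<comment> \<open>If the inner product \<open>p\<close> were nonzero, moving from \<open>v\<close> a little in the direction of \<open>w\<close>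
        with the sign of \<open>p\<close> would increase the Rayleigh quotient to first order.\<close>
      define p where "p = inner (f v) (f w)"
      define c where "c = (norm (f v) * norm w)\<^sup>2"
      have ineq: "2 * t * p \<le> t\<^sup>2 * c" for t
      proof -
        have "(norm (f (v + t *\<^sub>R w)))\<^sup>2 \<le> (norm (f v) * norm (v + t *\<^sub>R w))\<^sup>2"
          using rayleigh[of "v + t *\<^sub>R w"] vH w less.prems
          by (intro power_mono) (auto intro: subspace_add subspace_mul)
        moreover have "(norm (v + t *\<^sub>R w))\<^sup>2 = 1 + t\<^sup>2 * (norm w)\<^sup>2"
          using w nv unfolding power2_norm_eq_inner norm_eq_1
          by (simp add: inner_add_left inner_add_right inner_commute) (simp add: power2_eq_square)
        moreover have "(norm (f (v + t *\<^sub>R w)))\<^sup>2 = (norm (f v))\<^sup>2 + 2 * t * p + t\<^sup>2 * (norm (f w))\<^sup>2"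
          unfolding power2_norm_eq_inner p_def linear_add[OF \<open>linear f\<close>] linear_scale[OF \<open>linear f\<close>]
          by (simp add: inner_add_left inner_add_right inner_commute) (simp add: power2_eq_square)
        ultimately have "2 * t * p + t\<^sup>2 * (norm (f w))\<^sup>2 \<le> t\<^sup>2 * c"
          by (simp add: c_def power_mult_distrib algebra_simps)
        moreover have "0 \<le> t\<^sup>2 * (norm (f w))\<^sup>2" by simp
        ultimately show ?thesis by linarith
      qed
      have c0: "0 \<le> c" by (simp add: c_def)
      have "2 * p\<^sup>2 / (c + 1) \<le> p\<^sup>2 * c / (c + 1)\<^sup>2"
        using ineq[of "p / (c + 1)"] by (simp add: power2_eq_square)
      then have "2 * p\<^sup>2 * (c + 1) \<le> p\<^sup>2 * c"
        using c0 by (simp add: divide_simps power2_eq_square mult.assoc split: if_splits)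
      then have "p\<^sup>2 * (c + 2) \<le> 0" by (simp add: algebra_simps)
      then show ?thesis using c0 by (simp add: mult_le_0_iff p_def)
    qed
    let ?H = "H \<inter> {w. inner v w = 0}"
    have sub: "subspace ?H"
      using less.prems subspace_hyperplane by (intro subspace_inter)
    have "v \<notin> ?H" using nv by (auto simp: norm_eq_1)
    then have "?H \<noteq> H" using vH by metis
    then have "?H \<subset> H" by blast
    then have "dim ?H < dim H"
      using dim_psubset[of ?H H] by (metis less.prems span_eq_iff sub)
    from less.hyps[OF this sub] obtain B where B: "B \<subseteq> ?H" "pairwise orthogonal B"
      "\<forall>v\<in>B. norm v = 1" "span B = ?H" "pairwise (\<lambda>v w. orthogonal (f v) (f w)) B" by blast
    have "span (insert v B) = H"
    proof
      show "span (insert v B) \<subseteq> H"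
        using B(1) vH less.prems by (intro span_minimal) auto
      show "H \<subseteq> span (insert v B)"
      proof
        fix x assume x: "x \<in> H"
        have "x - inner v x *\<^sub>R v \<in> ?H"
          using x vH less.prems nv by (auto simp: subspace_diff subspace_mul inner_diff_right norm_eq_1)
        then have "x - inner v x *\<^sub>R v \<in> span B" using B(4) by simp
        then show "x \<in> span (insert v B)" by (auto simp: span_insert)
      qed
    qed
    moreover have "pairwise orthogonal (insert v B)"
      using B(1,2) by (auto simp: pairwise_insert orthogonal_def inner_commute)
    moreover have "pairwise (\<lambda>v w. orthogonal (f v) (f w)) (insert v B)"
      using B(1,5) crit by (auto simp: pairwise_insert orthogonal_def inner_commute)
    ultimately show ?thesis
      using B(1,3) vH nv by (intro exI[of _ "insert v B"]) auto
  qed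
qed

definition outer :: "real^'m \<Rightarrow> real^'n \<Rightarrow> real^'n^'m" where
  "outer a b = (\<chi> i j. a $ i * b $ j)"

lemma inner_outer: "inner (outer a b) (outer c d) = inner a c * inner b d"
  unfolding outer_def inner_vec_def sum_product by (simp add: mult_ac)

lemma norm_outer: "norm (outer a b) = norm a * norm b"
  by (simp add: norm_eq_sqrt_inner inner_outer real_sqrt_mult)

lemma mult_outer: "A ** outer a b = outer (A *v a) b"
  by (vector outer_def matrix_matrix_mult_def matrix_vector_mult_def sum_distrib_right mult.assoc)

lemma outer_mult: "outer a b ** A = outer a (transpose A *v b)"
  by (vector outer_def matrix_matrix_mult_def matrix_vector_mult_def sum_distrib_left
      transpose_def mult_ac)

lemma transpose_outer: "transpose (outer a b) = outer b a"
  by (vector outer_def transpose_def mult.commute)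

lemma outer_vector: "outer a b *v c = inner b c *\<^sub>R a"
  by (vector outer_def matrix_vector_mult_def inner_vec_def sum_distrib_left mult_ac)

lemma matrix_sum_left: "A ** (\<Sum>i\<in>I. B i) = (\<Sum>i\<in>I. A ** (B i :: real^'k^'n))"
  for A :: "real^'n^'m"
  by (induction I rule: infinite_finite_induct) (simp_all add: matrix_add_ldistrib)

lemma matrix_sum_right: "(\<Sum>i\<in>I. B i) ** A = (\<Sum>i\<in>I. (B i :: real^'n^'m) ** A)"
  for A :: "real^'k^'n"
  by (induction I rule: infinite_finite_induct) (simp_all add: matrix_add_right)

lemma transpose_sum: "transpose (\<Sum>i\<in>I. A i) = (\<Sum>i\<in>I. transpose (A i :: real^'n^'m))"
  by (induction I rule: infinite_finite_induct) (simp_all add: transpose_add)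

lemma sum_matrix_vector: "(\<Sum>i\<in>I. A i) *v x = (\<Sum>i\<in>I. (A i :: real^'n^'m) *v x)"
  by (induction I rule: infinite_finite_induct) (simp_all add: matrix_vector_mult_add_rdistrib)

lemma norm_sum_outer_right:
  assumes "finite B" "pairwise orthogonal B" "\<forall>v\<in>B. norm v = 1"
  shows "(norm (\<Sum>v\<in>B. outer (g v) v))\<^sup>2 = (\<Sum>v\<in>B. (norm (g v))\<^sup>2)"
proof -
  have "(norm (\<Sum>v\<in>B. outer (g v) v))\<^sup>2 = (\<Sum>v\<in>B. (norm (outer (g v) v))\<^sup>2)"
    using assms by (intro norm_sum_Pythagorean) (auto simp: pairwise_def orthogonal_def inner_outer)
  then show ?thesis using assms by (simp add: norm_outer)
qed

text \<open>The redundant columns may be badly unbalanced: \<open>X Y\<^sup>T\<close> can be tiny while \<open>X\<close> and \<open>Y\<close> are both of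
  moderate size. Still \<open>X Y\<^sup>T = (X (n - Q)) Y\<^sup>T + X (Y Q)\<^sup>T\<close> writes the product as a first-order variation
  of the factors by amounts whose squares are of the order of \<open>X Y\<^sup>T\<close>. In an orthonormal basis of the
  range of \<open>n\<close> whose images under \<open>X\<close> are orthogonal, \<open>X Y\<^sup>T\<close> is the orthogonal sum of the rank-one
  matrices \<open>(X v) (Y v)\<^sup>T\<close>, so for every basis vector the shorter of \<open>X v\<close> and \<open>Y v\<close> has squared length at
  most the norm of \<open>X Y\<^sup>T\<close>; \<open>Q\<close> projects onto the basis vectors for which \<open>Y v\<close> is the shorter one.\<close>

lemma splitting:
  fixes X :: "real^'r^'m" and Y :: "real^'r^'n"
  assumes n: "orthogonal_projection n" and Xn: "X ** n = X"
  obtains Q where "transpose Q = Q"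
    "(norm (X ** (n - Q)))\<^sup>2 + (norm (Y ** Q))\<^sup>2 \<le> real (rank n) * norm (X ** transpose Y)"
proof -
  let ?H = "range (\<lambda>a. n *v a)"
  have "subspace ?H" by (simp add: linear_subspace_image)
  then obtain B where B: "B \<subseteq> ?H" "pairwise orthogonal B" "\<forall>v\<in>B. norm v = 1" "span B = ?H"
      and orthX: "pairwise (\<lambda>v w. orthogonal (X *v v) (X *v w)) B"
    using orthonormal_basis_with_orthogonal_images[of "(*v) X" ?H] by auto
  have ind: "independent B"
    using B(2,3) by (intro pairwise_orthogonal_independent) auto
  then have fin: "finite B" by (rule independent_imp_finite)
  have card: "card B = rank n"
    using B(4) ind by (metis dim_span_eq_card_independent rank_dim_range)
  have nB: "n *v v = v" if "v \<in> B" for v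
    using B(1) that n by (force simp: orthogonal_projection_def matrix_vector_mul_assoc)
  have n_eq: "n = (\<Sum>v\<in>B. outer v v)"
  proof (subst matrix_eq, intro allI)
    fix a
    have "n *v a = (\<Sum>v\<in>B. inner (n *v a) v *\<^sub>R v)"
      using orthonormal_basis_expand[of B "n *v a"] B fin by auto
    also have "\<dots> = (\<Sum>v\<in>B. inner v a *\<^sub>R v)"
    proof (intro sum.cong refl)
      fix v assume "v \<in> B"
      then have "inner (n *v a) v = inner v a"
        using n nB[of v] by (metis inner_commute inner_matrix_vector orthogonal_projection_def)
      then show "inner (n *v a) v *\<^sub>R v = inner v a *\<^sub>R v" by simp
    qed
    finally show "n *v a = (\<Sum>v\<in>B. outer v v) *v a"
      by (simp add: sum_matrix_vector outer_vector)
  qed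
  define I where "I = {v \<in> B. norm (Y *v v) < norm (X *v v)}"
  define Q where "Q = (\<Sum>v\<in>I. outer v v)"
  have IB: "I \<subseteq> B" by (auto simp: I_def)
  have finI: "finite I" "finite (B - I)" using fin IB finite_subset by auto
  have "n - Q = (\<Sum>v\<in>B - I. outer v v)"
    unfolding n_eq Q_def using sum.subset_diff[OF IB fin, of "\<lambda>v. outer v v"] by simp
  then have "X ** (n - Q) = (\<Sum>v\<in>B - I. outer (X *v v) v)"
    by (simp add: matrix_sum_left mult_outer)
  moreover have "pairwise orthogonal (B - I)" "pairwise orthogonal I"
    using B(2) IB by (auto intro: pairwise_subset)
  ultimately have XQ: "(norm (X ** (n - Q)))\<^sup>2 = (\<Sum>v\<in>B - I. (norm (X *v v))\<^sup>2)"
    using finI B(3) norm_sum_outer_right[of "B - I" "\<lambda>v. X *v v"] by simp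
  have "Y ** Q = (\<Sum>v\<in>I. outer (Y *v v) v)"
    by (simp add: Q_def matrix_sum_left mult_outer)
  then have YQ: "(norm (Y ** Q))\<^sup>2 = (\<Sum>v\<in>I. (norm (Y *v v))\<^sup>2)"
    using finI B(3) IB \<open>pairwise orthogonal I\<close> norm_sum_outer_right[of I "\<lambda>v. Y *v v"] by auto
  let ?e = "norm (X ** transpose Y)"
  have "X ** transpose Y = (\<Sum>v\<in>B. outer (X *v v) (Y *v v))"
  proof -
    have "X ** transpose Y = X ** n ** transpose Y" by (simp add: Xn)
    then show ?thesis
      by (simp add: n_eq matrix_sum_left matrix_sum_right mult_outer outer_mult
        del: transpose_matrix_vector)
  qed
  then have e2: "?e\<^sup>2 = (\<Sum>v\<in>B. (norm (outer (X *v v) (Y *v v)))\<^sup>2)"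
    using orthX fin
    by (simp only:) (intro norm_sum_Pythagorean; auto simp: pairwise_def orthogonal_def inner_outer)
  (* Every rank-one term is at most the whole, because the terms are orthogonal. *)
  have each: "norm (X *v v) * norm (Y *v v) \<le> ?e" if "v \<in> B" for v
  proof -
    have "(norm (outer (X *v v) (Y *v v)))\<^sup>2 \<le> ?e\<^sup>2"
      unfolding e2 by (rule member_le_sum[OF that _ fin]) simp
    then show ?thesis by (simp add: norm_outer power2_le_iff_abs_le)
  qed
  have "(norm (X ** (n - Q)))\<^sup>2 \<le> (\<Sum>v\<in>B - I. ?e)"
    unfolding XQ
  proof (rule sum_mono)
    fix v assume v: "v \<in> B - I"
    then have "norm (X *v v) \<le> norm (Y *v v)" by (auto simp: I_def)
    then have "(norm (X *v v))\<^sup>2 \<le> norm (X *v v) * norm (Y *v v)"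
      by (simp add: power2_eq_square mult_left_mono)
    then show "(norm (X *v v))\<^sup>2 \<le> ?e" using each[of v] v by auto
  qed
  moreover have "(norm (Y ** Q))\<^sup>2 \<le> (\<Sum>v\<in>I. ?e)"
    unfolding YQ
  proof (rule sum_mono)
    fix v assume v: "v \<in> I"
    then have "norm (Y *v v) \<le> norm (X *v v)" by (auto simp: I_def)
    then have "(norm (Y *v v))\<^sup>2 \<le> norm (X *v v) * norm (Y *v v)"
      by (simp add: power2_eq_square mult_right_mono)
    then show "(norm (Y *v v))\<^sup>2 \<le> ?e" using each[of v] v IB by auto
  qed
  moreover have "(\<Sum>v\<in>B - I. ?e) + (\<Sum>v\<in>I. ?e) = (\<Sum>v\<in>B. ?e)"
    using sum.subset_diff[OF IB fin, of "\<lambda>_. ?e"] by simp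
  ultimately have "(norm (X ** (n - Q)))\<^sup>2 + (norm (Y ** Q))\<^sup>2 \<le> real (rank n) * ?e"
    using card by simp
  moreover have "transpose Q = Q" by (simp add: Q_def transpose_sum transpose_outer)
  ultimately show thesis by (intro that)
qed

section \<open>The error as a first-order variation of the factors\<close>

text \<open>\<open>G\<close> is the pseudoinverse of the well-conditioned part \<open>X ** p\<close>, which inherits its conditioning from
  \<open>Xs\<close>. Projecting away the column space of \<open>X ** p\<close> leaves only the redundant part of \<open>X\<close>.\<close>

lemma perturbed_pseudoinverse:
  fixes X Xs :: "real^'r^'m"
  assumes p: "orthogonal_projection p" and \<mu>: "0 < \<mu>"
    and lower: "\<And>a. \<mu> * norm (p *v a) \<le> norm (Xs *v a)"
    and close: "norm (X - Xs) \<le> \<mu> / 40"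
  obtains G where "p ** G = G" "op_bound G (2 / \<mu>)" "orthogonal_projection (X ** G)"
    "(mat 1 - X ** G) ** X = (mat 1 - X ** G) ** (X ** (mat 1 - p))"
proof -
  have pp: "p *v (p *v a) = p *v a" for a
    using p by (simp add: orthogonal_projection_def matrix_vector_mul_assoc)
  have "\<mu> / 2 * norm (p *v a) \<le> norm ((X ** p) *v a)" for a
  proof -
    have "\<mu> * norm (p *v a) \<le> norm (Xs *v (p *v a))"
      using lower[of "p *v a"] by (simp add: pp)
    moreover have "norm ((X - Xs) *v (p *v a)) \<le> \<mu> / 40 * norm (p *v a)"
      using op_bound_mono[OF op_bound_norm close] by (simp add: op_bound_def)
    moreover have "Xs *v (p *v a) = (X ** p) *v a - (X - Xs) *v (p *v a)"
      by (simp add: matrix_vector_mult_diff_rdistrib matrix_vector_mul_assoc matrix_distribs)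
    moreover have "norm ((X ** p) *v a - (X - Xs) *v (p *v a))
        \<le> norm ((X ** p) *v a) + norm ((X - Xs) *v (p *v a))"
      by (rule norm_triangle_ineq4)
    moreover have "0 \<le> \<mu> * norm (p *v a)" using \<mu> by simp
    ultimately show ?thesis by simp
  qed
  moreover have "X ** p ** p = X ** p"
    using p by (simp add: orthogonal_projection_def matrix_mul_assoc[symmetric])
  ultimately obtain G where G: "G ** (X ** p) = p" "p ** G = G"
    "orthogonal_projection (X ** p ** G)" "op_bound G (1 / (\<mu> / 2))"
    using pseudoinverse_exists[OF p, of "X ** p" "\<mu> / 2"] \<mu> by auto
  have XG: "X ** p ** G = X ** G" by (simp add: matrix_mul_assoc[symmetric] G(2))
  have "X ** G ** X ** p = X ** p"
  proof -
    have "X ** G ** X ** p = X ** (G ** (X ** p))" by (simp add: matrix_mul_assoc)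
    then show ?thesis by (simp add: G(1))
  qed
  then show thesis
    using G XG by (intro that) (simp_all add: matrix_distribs matrix_mul_assoc)
qed

text \<open>The geometric core: near the solution the error is, up to second order, a first-order variation of
  the factors, by an amount whose square is of the order of the error. Let \<open>L\<close> and \<open>R\<close> project away the
  column spaces of \<open>X ** p\<close> and \<open>Y ** p\<close>. Everything in \<open>e\<close> except \<open>L ** e ** R\<close> is a variation of these
  well-conditioned parts, of size \<open>norm e / \<mu>\<close>. As \<open>Xs\<close> and \<open>Ys\<close> have left inverses on the range of
  \<open>p\<close>, the remaining block of \<open>Xs ** transpose Ys\<close> can be expressed through \<open>e\<close> and the redundant parts
  \<open>Xt\<close>, \<open>Yt\<close>, like a Schur complement. This writes \<open>L ** e ** R\<close> as \<open>Xt ** A + B ** transpose Yt\<close> minus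
  a term quadratic in \<open>e\<close>; the only summands of \<open>A\<close> and \<open>B\<close> that are not of the order of \<open>e\<close> come from the product
  \<open>Xt ** (mat 1 - N ** M) ** transpose Yt\<close>, to which \<open>splitting\<close> applies. Finally \<open>Xt\<close> differs from \<open>X ** n\<close>
  by a matrix with columns in the column space of \<open>X ** p\<close>, so \<open>Xt ** A\<close> is a variation of \<open>Y\<close> as well, and
  symmetrically.\<close>

lemma tangent_approximation:
  fixes X Xs :: "real^'r^'m" and Y Ys :: "real^'r^'n" and p :: "real^'r^'r"
  assumes p: "orthogonal_projection p" and Xsp: "Xs ** p = Xs" and Ysp: "Ys ** p = Ys"
    and \<mu>: "0 < \<mu>"
    and lowerX: "\<And>a. \<mu> * norm (p *v a) \<le> norm (Xs *v a)"
    and lowerY: "\<And>a. \<mu> * norm (p *v a) \<le> norm (Ys *v a)"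
    and closeX: "norm (X - Xs) \<le> \<mu> / 40" and closeY: "norm (Y - Ys) \<le> \<mu> / 40"
    and e_def: "e = X ** transpose Y - Xs ** transpose Ys"
    and e_small: "norm e \<le> \<mu>\<^sup>2 / 2"
  obtains U V where "norm (e - (U ** transpose Y + X ** transpose V)) \<le> (norm e)\<^sup>2 / \<mu>\<^sup>2"
    "(norm (U, V))\<^sup>2 \<le> 100 * (real (rank (mat 1 - p)) + 1) * norm e"
proof -
  define n where "n = mat 1 - p"
  define \<epsilon> where "\<epsilon> = norm e"
  have \<epsilon>0: "0 \<le> \<epsilon>" by (simp add: \<epsilon>_def)
  have n: "orthogonal_projection n" using orthogonal_projection_compl[OF p] by (simp add: n_def)
  have nn: "n ** n = n" using n by (simp add: orthogonal_projection_def)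
  have n1: "op_bound n 1" by (rule orthogonal_projection_bound[OF n])
  obtain K where K: "K ** Xs = p" "p ** K = K" "op_bound K (1 / \<mu>)"
    using pseudoinverse_exists[OF p Xsp lowerX \<mu>] by metis
  obtain K' where K': "K' ** Ys = p" "p ** K' = K'" "op_bound K' (1 / \<mu>)"
    using pseudoinverse_exists[OF p Ysp lowerY \<mu>] by metis
  define H where "H = transpose K'"
  have H: "transpose Ys ** H = p" "op_bound H (1 / \<mu>)"
    using K'(1) p op_bound_transpose[OF K'(3)]
    by (auto simp: H_def matrix_transpose_mul[symmetric] orthogonal_projection_def)
  obtain G where G: "p ** G = G" "op_bound G (2 / \<mu>)" "orthogonal_projection (X ** G)"
    "(mat 1 - X ** G) ** X = (mat 1 - X ** G) ** (X ** n)"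
    using perturbed_pseudoinverse[OF p \<mu> lowerX closeX] unfolding n_def by metis
  obtain G' where G': "p ** G' = G'" "op_bound G' (2 / \<mu>)" "orthogonal_projection (Y ** G')"
    "(mat 1 - Y ** G') ** Y = (mat 1 - Y ** G') ** (Y ** n)"
    using perturbed_pseudoinverse[OF p \<mu> lowerY closeY] unfolding n_def by metis
  define L where "L = mat 1 - X ** G"
  define R where "R = mat 1 - Y ** G'"
  have L1: "op_bound L 1" and R1: "op_bound R 1" and symR: "transpose R = R"
    using orthogonal_projection_compl[OF G(3)] orthogonal_projection_compl[OF G'(3)]
      orthogonal_projection_bound by (auto simp: L_def R_def orthogonal_projection_def)
  define X2 where "X2 = X ** n"
  define Y2 where "Y2 = Y ** n"
  define Xt where "Xt = L ** X2"
  define Yt where "Yt = R ** Y2"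
  have LX: "L ** X = Xt" and RY: "R ** Y = Yt"
    using G(4) G'(4) by (auto simp: L_def R_def Xt_def Yt_def X2_def Y2_def)
  have Xtn: "Xt ** n = Xt"
    by (simp add: Xt_def X2_def matrix_mul_assoc[symmetric] nn)
  have Ytn: "Yt ** n = Yt"
    by (simp add: Yt_def Y2_def matrix_mul_assoc[symmetric] nn)
  have YR: "transpose Y ** R = transpose Yt"
    using RY symR by (metis matrix_transpose_mul)
  have X2_le: "norm X2 \<le> \<mu> / 40"
  proof -
    have "X2 = (X - Xs) ** n" using Xsp by (simp add: X2_def n_def matrix_distribs)
    then show ?thesis using norm_mult_right[OF n1, of "X - Xs"] closeX by simp
  qed
  have Y2_le: "norm Y2 \<le> \<mu> / 40"
  proof -
    have "Y2 = (Y - Ys) ** n" using Ysp by (simp add: Y2_def n_def matrix_distribs)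
    then show ?thesis using norm_mult_right[OF n1, of "Y - Ys"] closeY by simp
  qed
  have Xt_le: "norm Xt \<le> \<mu> / 40" using norm_mult_left[OF L1, of X2] X2_le by (simp add: Xt_def)
  have Yt_le: "norm Yt \<le> \<mu> / 40" using norm_mult_left[OF R1, of Y2] Y2_le by (simp add: Yt_def)
  define N where "N = transpose Y2 ** H"
  define M where "M = K ** X2"
  have N_le: "norm N \<le> 1 / 40"
  proof -
    have "norm N \<le> norm Y2 * (1 / \<mu>)" using norm_mult_right[OF H(2), of "transpose Y2"] by (simp add: N_def)
    also have "\<dots> \<le> \<mu> / 40 * (1 / \<mu>)" using Y2_le \<mu> by (intro mult_right_mono) auto
    finally show ?thesis using \<mu> by simp
  qed
  have M_le: "norm M \<le> 1 / 40"
  proof -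
    have "norm M \<le> 1 / \<mu> * norm X2" using norm_mult_left[OF K(3), of X2] by (simp add: M_def)
    also have "\<dots> \<le> 1 / \<mu> * (\<mu> / 40)" using X2_le \<mu> by (intro mult_left_mono) auto
    finally show ?thesis using \<mu> by simp
  qed
  \<comment> \<open>The solution factors, projected, in terms of the error and the redundant parts: multiply \<open>e\<close> by
    a right inverse of \<open>transpose Ys\<close>, respectively by a left inverse of \<open>Xs\<close>.\<close>
  have LXs: "L ** Xs = Xt ** N - L ** e ** H"
  proof -
    have "L ** e ** H = L ** X ** transpose Y ** H - L ** (Xs ** (transpose Ys ** H))"
      by (simp add: e_def matrix_distribs matrix_mul_assoc)
    also have "L ** X ** transpose Y = Xt ** transpose Y2"
      using n Xtn by (simp add: LX Y2_def matrix_transpose_mul orthogonal_projection_def matrix_mul_assoc)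
    finally show ?thesis by (simp add: H(1) Xsp N_def matrix_mul_assoc)
  qed
  have YsR: "transpose Ys ** R = M ** transpose Yt - K ** e ** R"
  proof -
    have "K ** e ** R = K ** X ** (transpose Y ** R) - K ** Xs ** transpose Ys ** R"
      by (simp add: e_def matrix_distribs matrix_mul_assoc)
    also have "K ** X ** (transpose Y ** R) = M ** transpose Yt"
    proof -
      have "transpose Yt = n ** transpose Yt"
        using Ytn n by (metis matrix_transpose_mul orthogonal_projection_def)
      then show ?thesis unfolding YR M_def X2_def by (metis matrix_mul_assoc)
    qed
    also have "K ** Xs ** transpose Ys = transpose Ys"
      unfolding K(1) using Ysp p by (metis matrix_transpose_mul orthogonal_projection_def)
    finally show ?thesis by simp
  qed
  define \<rho> where "\<rho> = L ** e ** H ** K ** e ** R"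
  define A0 where "A0 = N ** K ** e ** R"
  define B0 where "B0 = L ** e ** H ** M"
  define Yh where "Yh = Yt ** transpose (mat 1 - N ** M)"
  have LeR: "L ** e ** R = Xt ** transpose Yh + Xt ** A0 + B0 ** transpose Yt - \<rho>"
  proof -
    have "L ** e ** R = L ** X ** (transpose Y ** R) - L ** Xs ** (transpose Ys ** R)"
      by (simp add: e_def matrix_distribs matrix_mul_assoc)
    also have "\<dots> = Xt ** transpose Yt
        - (Xt ** N - L ** e ** H) ** (M ** transpose Yt - K ** e ** R)"
      by (simp only: LX YR LXs YsR)
    also have "\<dots> = Xt ** transpose Yh + Xt ** A0 + B0 ** transpose Yt - \<rho>"
      by (simp add: Yh_def A0_def B0_def \<rho>_def matrix_distribs transpose_distribs matrix_mul_assoc)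
    finally show ?thesis .
  qed
  have Le: "norm (L ** e) \<le> \<epsilon>" using norm_mult_left[OF L1, of e] by (simp add: \<epsilon>_def)
  have LeH: "norm (L ** e ** H) \<le> \<epsilon> / \<mu>"
    using norm_mult_right[OF H(2), of "L ** e"] Le \<mu> by (simp add: divide_right_mono order_trans)
  have KeR: "norm (K ** e ** R) \<le> \<epsilon> / \<mu>"
    using norm_mult_right[OF R1, of "K ** e"] norm_mult_left[OF K(3), of e] by (simp add: \<epsilon>_def)
  have A0_le: "norm A0 \<le> 1 / 40 * (\<epsilon> / \<mu>)"
  proof -
    have "norm A0 \<le> norm N * norm (K ** e ** R)"
      using norm_mult_le[of N "K ** e ** R"] by (simp add: A0_def matrix_mul_assoc)
    also have "\<dots> \<le> 1 / 40 * (\<epsilon> / \<mu>)" using N_le KeR by (intro mult_mono) auto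
    finally show ?thesis .
  qed
  have B0_le: "norm B0 \<le> 1 / 40 * (\<epsilon> / \<mu>)"
  proof -
    have "norm B0 \<le> norm (L ** e ** H) * norm M"
      using norm_mult_le[of "L ** e ** H" M] by (simp add: B0_def)
    also have "\<dots> \<le> (\<epsilon> / \<mu>) * (1 / 40)"
      using M_le LeH \<epsilon>0 \<mu> by (intro mult_mono) auto
    finally show ?thesis by simp
  qed
  have \<rho>_le: "norm \<rho> \<le> \<epsilon>\<^sup>2 / \<mu>\<^sup>2"
  proof -
    have "norm \<rho> \<le> norm (L ** e ** H) * norm (K ** e ** R)"
      using norm_mult_le[of "L ** e ** H" "K ** e ** R"] by (simp add: \<rho>_def matrix_mul_assoc)
    also have "\<dots> \<le> (\<epsilon> / \<mu>) * (\<epsilon> / \<mu>)"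
      using KeR LeH \<epsilon>0 \<mu> by (intro mult_mono) auto
    finally show ?thesis by (simp add: power2_eq_square)
  qed
  obtain Q where symQ: "transpose Q = Q" and
    split: "(norm (Xt ** (n - Q)))\<^sup>2 + (norm (Yh ** Q))\<^sup>2 \<le> real (rank n) * norm (Xt ** transpose Yh)"
    using splitting[OF n Xtn, of Yh] by blast
  define a where "a = norm (Yh ** Q)"
  define b where "b = norm (Xt ** (n - Q))"
  have XtYh: "norm (Xt ** transpose Yh) \<le> 2 * \<epsilon>"
  proof -
    have "norm (L ** e ** R) \<le> \<epsilon>" using norm_mult_right[OF R1, of "L ** e"] Le by simp
    moreover have "norm \<rho> \<le> \<epsilon> / 2"
    proof -
      have "\<epsilon> * \<epsilon> \<le> \<epsilon> * (\<mu>\<^sup>2 / 2)" using e_small \<epsilon>0 by (intro mult_left_mono) (simp_all add: \<epsilon>_def)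
      then have "\<epsilon>\<^sup>2 / \<mu>\<^sup>2 \<le> \<epsilon> / 2" using \<mu> by (simp add: field_simps power2_eq_square)
      with \<rho>_le show ?thesis by linarith
    qed
    moreover have "norm (Xt ** A0) \<le> \<epsilon> / 1600"
    proof -
      have "norm (Xt ** A0) \<le> norm Xt * norm A0" by (rule norm_mult_le)
      also have "\<dots> \<le> \<mu> / 40 * (1 / 40 * (\<epsilon> / \<mu>))" using Xt_le A0_le \<mu> by (intro mult_mono) auto
      finally show ?thesis using \<mu> by simp
    qed
    moreover have "norm (B0 ** transpose Yt) \<le> \<epsilon> / 1600"
    proof -
      have "norm (B0 ** transpose Yt) \<le> norm B0 * norm Yt"
        using norm_mult_le[of B0 "transpose Yt"] by simp
      also have "\<dots> \<le> 1 / 40 * (\<epsilon> / \<mu>) * (\<mu> / 40)"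
        using Yt_le B0_le \<mu> \<epsilon>0 by (intro mult_mono) auto
      finally show ?thesis using \<mu> by simp
    qed
    moreover have "Xt ** transpose Yh = L ** e ** R + \<rho> - (Xt ** A0 + B0 ** transpose Yt)"
      using LeR by simp
    moreover have "norm (L ** e ** R + \<rho> - (Xt ** A0 + B0 ** transpose Yt))
      \<le> (norm (L ** e ** R) + norm \<rho>) + (norm (Xt ** A0) + norm (B0 ** transpose Yt))"
      by (intro norm_triangle_le_diff add_mono norm_triangle_ineq)
    ultimately show ?thesis using \<epsilon>0 by simp
  qed
  have ab: "a\<^sup>2 + b\<^sup>2 \<le> 2 * real (rank n) * \<epsilon>"
  proof -
    have "real (rank n) * norm (Xt ** transpose Yh) \<le> real (rank n) * (2 * \<epsilon>)"
      using XtYh by (intro mult_left_mono) auto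
    then show ?thesis using split by (simp add: a_def b_def)
  qed
  define A where "A = transpose (Yh ** Q) + A0"
  define B where "B = Xt ** (n - Q) ** (mat 1 - N ** M) + B0"
  have A_le: "norm A \<le> a + 1 / 40 * (\<epsilon> / \<mu>)"
    unfolding A_def using A0_le by (intro norm_triangle_le add_mono) (simp_all add: a_def)
  have B_le: "norm B \<le> 2 * b + 1 / 40 * (\<epsilon> / \<mu>)"
  proof -
    have "norm (N ** M) \<le> 1 / 40 * (1 / 40)"
      by (rule order_trans[OF norm_mult_le]) (use N_le M_le in \<open>intro mult_mono; simp\<close>)
    then have "op_bound (N ** M) 1" by (intro op_bound_mono[OF op_bound_norm]) simp
    then have "op_bound (mat 1 - N ** M) 2" using op_bound_diff[OF op_bound_mat_1] by fastforce
    from norm_mult_right[OF this, of "Xt ** (n - Q)"]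
    show ?thesis
      unfolding B_def using B0_le by (intro norm_triangle_le add_mono) (simp_all add: b_def mult.commute)
  qed
  have LeR2: "L ** e ** R = Xt ** A + B ** transpose Yt - \<rho>"
  proof -
    have "Xt ** transpose Yh = Xt ** n ** transpose Yh" by (simp add: Xtn)
    also have "\<dots> = Xt ** (n - Q) ** transpose Yh + Xt ** transpose (Yh ** Q)"
      by (simp add: matrix_distribs transpose_distribs symQ matrix_mul_assoc)
    also have "Xt ** (n - Q) ** transpose Yh = Xt ** (n - Q) ** (mat 1 - N ** M) ** transpose Yt"
      by (simp only: Yh_def matrix_transpose_mul transpose_transpose matrix_mul_assoc)
    finally show ?thesis
      unfolding LeR A_def B_def matrix_add_ldistrib matrix_add_right by simp
  qed
  (* Undo the projection by compensating in the well-conditioned columns. *)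
  have lift: "LL ** (XX ** n) ** C = XX ** (n ** C - GG ** (XX ** n) ** C)"
    if "LL = mat 1 - XX ** GG" for LL GG C and XX :: "real^'r^'k"
    by (simp add: that matrix_distribs matrix_mul_assoc)
  have lift_le: "norm (n ** C - GG ** Z ** C) \<le> 2 * norm C"
    if "op_bound GG (2 / \<mu>)" "norm Z \<le> \<mu> / 40" for GG C and Z :: "real^'r^'k"
  proof -
    have "norm (GG ** Z) \<le> 2 / \<mu> * norm Z" by (rule norm_mult_left[OF that(1)])
    also have "\<dots> \<le> 2 / \<mu> * (\<mu> / 40)" using that(2) \<mu> by (intro mult_left_mono) auto
    finally have "op_bound (GG ** Z) 1" using \<mu> by (intro op_bound_mono[OF op_bound_norm]) simp
    then have "op_bound (n - GG ** Z) 2" using op_bound_diff[OF n1] by fastforce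
    then show ?thesis using norm_mult_left[of "n - GG ** Z" 2 C] by (simp add: matrix_distribs)
  qed
  define V where "V = transpose (G ** e + (n ** A - G ** X2 ** A))"
  define U where "U = L ** e ** transpose G' + transpose (n ** transpose B - G' ** Y2 ** transpose B)"
  have eq: "e = U ** transpose Y + X ** transpose V - \<rho>"
  proof -
    have "e = X ** G ** e + L ** e ** (Y ** G') + L ** e ** R"
      by (simp add: L_def R_def matrix_distribs matrix_mul_assoc)
    also have "Y ** G' = transpose G' ** transpose Y"
      using G'(3) by (metis matrix_transpose_mul orthogonal_projection_def)
    also have "L ** e ** R = X ** (n ** A - G ** X2 ** A)
        + transpose (n ** transpose B - G' ** Y2 ** transpose B) ** transpose Y - \<rho>"
    proof -
      have "Xt ** A = X ** (n ** A - G ** X2 ** A)"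
        unfolding Xt_def X2_def by (rule lift[OF L_def])
      moreover have "Yt ** transpose B = Y ** (n ** transpose B - G' ** Y2 ** transpose B)"
        unfolding Yt_def Y2_def by (rule lift[OF R_def])
      then have "B ** transpose Yt = transpose (n ** transpose B - G' ** Y2 ** transpose B) ** transpose Y"
        by (metis matrix_transpose_mul transpose_transpose)
      ultimately show ?thesis by (simp add: LeR2)
    qed
    finally show ?thesis
      unfolding U_def V_def transpose_transpose matrix_add_ldistrib matrix_add_right
      by (simp add: matrix_mul_assoc algebra_simps)
  qed
  have "norm (e - (U ** transpose Y + X ** transpose V)) \<le> (norm e)\<^sup>2 / \<mu>\<^sup>2"
  proof -
    have "e - (U ** transpose Y + X ** transpose V) = - \<rho>" using eq by (metis add_diff_cancel_left' diff_minus_eq_add minus_diff_eq uminus_add_conv_diff)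
    then show ?thesis using \<rho>_le by (simp add: \<epsilon>_def)
  qed
  moreover have "(norm (U, V))\<^sup>2 \<le> 100 * (real (rank (mat 1 - p)) + 1) * norm e"
  proof -
    have t0: "0 \<le> \<epsilon> / \<mu>" using \<epsilon>0 \<mu> by simp
    have Ge: "norm (G ** e) \<le> 2 * (\<epsilon> / \<mu>)" using norm_mult_left[OF G(2), of e] by (simp add: \<epsilon>_def)
    have LeG: "norm (L ** e ** transpose G') \<le> 2 * (\<epsilon> / \<mu>)"
    proof -
      have "norm (L ** e ** transpose G') \<le> norm (L ** e) * (2 / \<mu>)"
        by (rule norm_mult_right[OF op_bound_transpose[OF G'(2)]])
      also have "\<dots> \<le> \<epsilon> * (2 / \<mu>)" using Le \<mu> by (intro mult_right_mono) auto
      finally show ?thesis by (simp add: mult.commute)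
    qed
    have "norm V \<le> norm (G ** e) + norm (n ** A - G ** X2 ** A)"
      by (simp add: V_def norm_triangle_ineq)
    moreover have "norm (n ** A - G ** X2 ** A) \<le> 2 * norm A" by (rule lift_le[OF G(2) X2_le])
    ultimately have V_le: "norm V \<le> 3 * (\<epsilon> / \<mu>) + 2 * a" using Ge A_le t0 by linarith
    have "norm U \<le> norm (L ** e ** transpose G') + norm (n ** transpose B - G' ** Y2 ** transpose B)"
      unfolding U_def by (metis norm_transpose norm_triangle_ineq)
    moreover have "norm (n ** transpose B - G' ** Y2 ** transpose B) \<le> 2 * norm B"
      using lift_le[OF G'(2) Y2_le, of "transpose B"] by simp
    ultimately have U_le: "norm U \<le> 3 * (\<epsilon> / \<mu>) + 4 * b" using LeG B_le t0 by linarith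
    have sq: "(x + y)\<^sup>2 \<le> 2 * x\<^sup>2 + 2 * y\<^sup>2" for x y :: real
      using sum_squares_ge_zero[of "x - y" 0] by (simp add: power2_eq_square algebra_simps)
    have small: "(3 * (\<epsilon> / \<mu>))\<^sup>2 \<le> 5 * \<epsilon>"
    proof -
      have "\<epsilon> * \<epsilon> \<le> \<epsilon> * (\<mu>\<^sup>2 / 2)" using e_small \<epsilon>0 by (intro mult_left_mono) (simp_all add: \<epsilon>_def)
      then have "(\<epsilon> / \<mu>)\<^sup>2 \<le> \<epsilon> / 2" using \<mu> by (simp add: field_simps power2_eq_square)
      then show ?thesis using \<epsilon>0 unfolding power_mult_distrib by simp
    qed
    have "(norm V)\<^sup>2 \<le> (3 * (\<epsilon> / \<mu>) + 2 * a)\<^sup>2" using V_le by (intro power_mono) auto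
    also have "\<dots> \<le> 10 * \<epsilon> + 8 * a\<^sup>2"
      using sq[of "3 * (\<epsilon> / \<mu>)" "2 * a"] small by (simp add: power_mult_distrib)
    finally have V2: "(norm V)\<^sup>2 \<le> 10 * \<epsilon> + 8 * a\<^sup>2" .
    have "(norm U)\<^sup>2 \<le> (3 * (\<epsilon> / \<mu>) + 4 * b)\<^sup>2" using U_le by (intro power_mono) auto
    also have "\<dots> \<le> 10 * \<epsilon> + 32 * b\<^sup>2"
      using sq[of "3 * (\<epsilon> / \<mu>)" "4 * b"] small by (simp add: power_mult_distrib)
    finally have "(norm U)\<^sup>2 \<le> 10 * \<epsilon> + 32 * b\<^sup>2" .
    moreover have "(norm (U, V))\<^sup>2 = (norm U)\<^sup>2 + (norm V)\<^sup>2" by (simp add: norm_Pair)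
    ultimately have "(norm (U, V))\<^sup>2 \<le> 20 * \<epsilon> + 32 * (a\<^sup>2 + b\<^sup>2)"
      using V2 zero_le_power2[of a] unfolding distrib_left by linarith
    also have "\<dots> \<le> 100 * (real (rank n) + 1) * \<epsilon>"
    proof -
      have "0 \<le> real (rank n) * \<epsilon>" using \<epsilon>0 by simp
      moreover have "100 * (real (rank n) + 1) * \<epsilon> = 100 * (real (rank n) * \<epsilon>) + 100 * \<epsilon>"
        by (simp add: algebra_simps)
      moreover have "32 * (a\<^sup>2 + b\<^sup>2) \<le> 32 * (2 * real (rank n) * \<epsilon>)"
        using ab by (intro mult_left_mono) simp_all
      then have "32 * (a\<^sup>2 + b\<^sup>2) \<le> 64 * (real (rank n) * \<epsilon>)" by simp
      ultimately show ?thesis using \<epsilon>0 by linarith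
    qed
    finally show ?thesis by (simp add: n_def \<epsilon>_def)
  qed
  ultimately show thesis by (rule that)
qed

section \<open>Damped least squares and derivatives\<close>

lemma rank_diff_le: "rank (A - B) \<le> rank A + rank (B :: real^'n^'m)"
proof -
  let ?S = "{x + y |x y. x \<in> range ((*v) A) \<and> y \<in> range ((*v) B)}"
  have sub: "subspace (range ((*v) A))" "subspace (range ((*v) B))"
    by (simp_all add: linear_subspace_image)
  have "range ((*v) (A - B)) \<subseteq> ?S"
  proof (intro subsetI)
    fix z assume "z \<in> range ((*v) (A - B))"
    then obtain a where "z = A *v a + B *v (- a)"
      by (auto simp: matrix_vector_mult_diff_rdistrib linear_neg[OF matrix_vector_mul_linear])
    then show "z \<in> ?S" by blast
  qed
  then have "dim (range ((*v) (A - B))) \<le> dim ?S" by (rule dim_subset)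
  also have "\<dots> \<le> rank A + rank B"
    using dim_sums_Int[OF sub] by (simp add: rank_dim_range)
  finally show ?thesis by (simp add: rank_dim_range)
qed

lemma rank_add_le: "rank (A + B) \<le> rank A + rank (B :: real^'n^'m)"
proof -
  have "rank (- B) = rank (- mat 1 ** B)" by (simp add: matrix_minus_right)
  also have "\<dots> \<le> rank B" by (rule rank_mul_le_right)
  finally show ?thesis using rank_diff_le[of A "- B"] by simp
qed

lemma rank_mult_inner_dim: "rank (A ** B) \<le> CARD('r)" for A :: "real^'r^'m" and B :: "real^'n^'r"
  using rank_mul_le_left[of A B] rank_bound[of A] by simp

lemma closest_point_subspace:
  fixes S :: "'a::euclidean_space set"
  assumes "subspace S"
  shows "closest_point S v \<in> S" "w \<in> S \<Longrightarrow> inner (closest_point S v) w = inner v w"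
proof -
  have cl: "closed S" "convex S" "S \<noteq> {}"
    using assms closed_subspace subspace_imp_convex subspace_0 by auto
  show mem: "closest_point S v \<in> S" by (rule closest_point_in_set[OF cl(1,3)])
  assume w: "w \<in> S"
  have "inner (v - closest_point S v) w \<le> 0"
    using closest_point_dot[OF cl(2,1), of "closest_point S v + w" v] mem w assms
    by (simp add: subspace_add)
  moreover have "inner (v - closest_point S v) (- w) \<le> 0"
    using closest_point_dot[OF cl(2,1), of "closest_point S v - w" v] mem w assms
    by (simp add: subspace_diff)
  ultimately show "inner (closest_point S v) w = inner v w" by (simp add: inner_diff_left)
qed

text \<open>The minimizer of \<open>(norm (w - J u))\<^sup>2 + l * (norm u)\<^sup>2\<close>, in the form in which the method computes it.\<close>

definition damped_solution ::
    "('a::euclidean_space \<Rightarrow> 'b::euclidean_space) \<Rightarrow> real \<Rightarrow> 'b \<Rightarrow> 'a" where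
  "damped_solution J l w = inv (\<lambda>u. adjoint J (J u) + l *\<^sub>R u) (adjoint J w)"

context
  fixes J :: "'a::euclidean_space \<Rightarrow> 'b::euclidean_space" and l :: real
  assumes J: "linear J" and l: "0 < l"
begin

lemma damped_solution_eq: 
  "adjoint J (J (damped_solution J l w)) + l *\<^sub>R damped_solution J l w = adjoint J w"
proof -
  let ?T = "\<lambda>u. adjoint J (J u) + l *\<^sub>R u"
  have lin: "linear ?T"
    using linear_compose[OF J adjoint_linear[OF J]]
    by (intro linear_compose_add linear_scale_self) (simp add: o_def)
  have "x = 0" if "?T x = 0" for x
  proof -
    have "inner x (?T x) = (norm (J x))\<^sup>2 + l * (norm x)\<^sup>2"
      by (simp add: inner_add_right adjoint_works[OF J] power2_norm_eq_inner)
    then have "(norm (J x))\<^sup>2 + l * (norm x)\<^sup>2 = 0" using that by simp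
    then have "l * (norm x)\<^sup>2 = 0" using l by (simp add: add_nonneg_eq_0_iff)
    then show ?thesis using l by simp
  qed
  then have "inj ?T" using linear_injective_0[OF lin] by blast
  then have "surj ?T" using linear_injective_imp_surjective[OF lin] by blast
  then show ?thesis unfolding damped_solution_def by (rule surj_f_inv_f)
qed

lemma damped_solution_inner:
  "inner (J (damped_solution J l w)) (J x) + l * inner (damped_solution J l w) x = inner w (J x)"
proof -
  have "inner (adjoint J (J (damped_solution J l w)) + l *\<^sub>R damped_solution J l w) x = inner (adjoint J w) x"
    by (simp only: damped_solution_eq)
  then show ?thesis
    by (simp add: inner_add_left adjoint_clauses(2)[OF J])
qed

text \<open>How far the damped projection \<open>J (J\<^sup>T J + l)\<^sup>-\<^sup>1 J\<^sup>T\<close> misses \<open>w\<close> can be estimated by exhibiting any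
  competitor \<open>u\<close> in the regularized least-squares problem.\<close>

lemma damped_solution_optimal:
  "(norm (w - J (damped_solution J l w)))\<^sup>2 \<le> (norm (w - J u))\<^sup>2 + l * (norm u)\<^sup>2"
proof -
  define d where "d = damped_solution J l w"
  define x where "x = u - d"
  have u: "u = d + x" by (simp add: x_def)
  have "inner (J d) (J x) + l * inner d x = inner w (J x)"
    unfolding d_def by (rule damped_solution_inner)
  then have "(norm (w - J u))\<^sup>2 + l * (norm u)\<^sup>2
      = (norm (w - J d))\<^sup>2 + l * (norm d)\<^sup>2 + (norm (J x))\<^sup>2 + l * (norm x)\<^sup>2"
    unfolding u linear_add[OF J] power2_norm_eq_inner
    by (simp add: inner_diff_left inner_diff_right inner_add_left inner_add_right inner_commute algebra_simps)
  moreover have "0 \<le> l * (norm d)\<^sup>2 + (norm (J x))\<^sup>2 + l * (norm x)\<^sup>2" using l by simp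
  ultimately show ?thesis by (simp add: d_def)
qed

lemma damped_solution_symmetric:
  "inner (J (damped_solution J l v)) w = inner v (J (damped_solution J l w))"
proof -
  have "inner (J (damped_solution J l v)) w
      = inner (J (damped_solution J l w)) (J (damped_solution J l v))
        + l * inner (damped_solution J l w) (damped_solution J l v)"
    by (simp only: damped_solution_inner inner_commute[of _ w])
  also have "\<dots> = inner v (J (damped_solution J l w))"
    by (simp only: damped_solution_inner[of v "damped_solution J l w", symmetric]
        inner_commute[of "J (damped_solution J l w)"] inner_commute[of "damped_solution J l w"])
  finally show ?thesis .
qed

text \<open>Both bounds follow because \<open>(norm (J d))\<^sup>2 + l * (norm d)\<^sup>2\<close> is the inner product of \<open>J d\<close> with the
  projection of \<open>v\<close> onto the range of \<open>J\<close>.\<close>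

lemma damped_solution_bounds:
  fixes v :: 'b
  defines "P \<equiv> closest_point (range J) v"
  shows "norm (J (damped_solution J l v)) \<le> norm P"
    and "4 * l * (norm (damped_solution J l v))\<^sup>2 \<le> (norm P)\<^sup>2"
proof -
  define d where "d = damped_solution J l v"
  have "subspace (range J)" using J by (simp add: linear_subspace_image)
  then have "inner P (J d) = inner v (J d)"
    unfolding P_def by (intro closest_point_subspace(2)) auto
  then have key: "(norm (J d))\<^sup>2 + l * (norm d)\<^sup>2 \<le> norm P * norm (J d)"
    using damped_solution_inner[of v d] norm_cauchy_schwarz[of P "J d"]
    by (simp add: power2_norm_eq_inner flip: d_def)
  have ld: "0 \<le> l * (norm d)\<^sup>2" using l by simp
  have "(norm P - 2 * norm (J d))\<^sup>2 \<ge> 0" by simp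
  then show "4 * l * (norm (damped_solution J l v))\<^sup>2 \<le> (norm P)\<^sup>2"
    using key by (simp add: power2_eq_square algebra_simps flip: d_def)
  have "norm (J d) * norm (J d) \<le> norm P * norm (J d)"
    using key ld unfolding power2_eq_square by linarith
  then show "norm (J (damped_solution J l v)) \<le> norm P"
    unfolding d_def[symmetric] by (cases "norm (J d) = 0") (simp_all only: mult_le_cancel_right, auto)
qed

end

lemma bounded_bilinear_mult_transpose:
  "bounded_bilinear (\<lambda>(X :: real^'r^'m) (Y :: real^'r^'n). X ** transpose Y)"
  unfolding bilinear_conv_bounded_bilinear[symmetric] bilinear_def
  by (auto intro!: linearI simp: matrix_distribs transpose_distribs)

lemma derivative_mult_transpose:
  "derivative (\<lambda>(U, V). U ** transpose V) (X :: real^'r^'m, Y :: real^'r^'n)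
    = (\<lambda>(U, V). U ** transpose Y + X ** transpose V)"
proof -
  have "((\<lambda>x. fst x ** transpose (snd x)) has_derivative
      (\<lambda>u. fst (X, Y) ** transpose (snd u) + fst u ** transpose (snd (X, Y)))) (at (X, Y))"
    by (intro bounded_bilinear.FDERIV[OF bounded_bilinear_mult_transpose]
        has_derivative_fst has_derivative_snd has_derivative_ident)
  then have "((\<lambda>(U, V). U ** transpose V) has_derivative
      (\<lambda>(U, V). U ** transpose Y + X ** transpose V)) (at (X, Y))"
    by (simp add: case_prod_beta' add.commute)
  then show ?thesis by (rule frechet_derivative_at[symmetric])
qed

lemma gradient_least_squares:
  fixes A :: "'a::euclidean_space \<Rightarrow> 'b::euclidean_space"
  assumes A: "linear A"
  shows "gradient (\<lambda>z. (norm (A z - b))\<^sup>2) z = 2 *\<^sub>R adjoint A (A z - b)"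
  unfolding gradient_def
proof (rule the_equality)
  have bl: "bounded_linear A" using A by (simp add: linear_conv_bounded_linear)
  have "((\<lambda>z. inner (A z - b) (A z - b)) has_derivative
      (\<lambda>h. inner (A z - b) (A h) + inner (A h) (A z - b))) (at z)"
    by (auto intro!: derivative_eq_intros bounded_linear.has_derivative[OF bl])
  then show gd: "GDERIV (\<lambda>z. (norm (A z - b))\<^sup>2) z :> 2 *\<^sub>R adjoint A (A z - b)"
    unfolding gderiv_def power2_norm_eq_inner
    by (rule has_derivative_eq_rhs) (auto simp: adjoint_works[OF A] inner_commute)
  fix v assume "GDERIV (\<lambda>z. (norm (A z - b))\<^sup>2) z :> v"
  with gd have "(\<lambda>h. inner h v) = (\<lambda>h. inner h (2 *\<^sub>R adjoint A (A z - b)))"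
    unfolding gderiv_def by (rule has_derivative_unique[THEN sym])
  then have "\<forall>h. inner h v = inner h (2 *\<^sub>R adjoint A (A z - b))"
    by (auto dest: fun_cong)
  then show "v = 2 *\<^sub>R adjoint A (A z - b)" by (simp only: vector_eq_ldot)
qed

section \<open>Contraction in one step\<close>

text \<open>A Polyak step contracts as soon as the direction \<open>p\<close> keeps an inner product with \<open>e\<close> of almost twice
  the function value \<open>t\<close>: the step removes \<open>7 / 2 * g * t\<close> from the squared error and returns at most
  \<open>\<gamma> * g * t\<close>, while the perturbation \<open>q\<close> costs only a small fraction of \<open>g * t\<close>. The number \<open>N\<close> stands for
  the norm of the projected gradient.\<close>

lemma polyak_contraction:
  fixes e p q :: "'b::real_inner"
  assumes \<gamma>: "0 < \<gamma>" "\<gamma> \<le> 1" and N: "0 < N" and t: "0 < t" and e: "e \<noteq> 0"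
    and g: "g = \<gamma> * (t / N\<^sup>2)"
    and p_le: "norm p \<le> N" and aim: "7 / 4 * t \<le> inner p e"
    and q_le: "norm q \<le> g * t / (11 * norm e)"
    and N_le: "N\<^sup>2 \<le> 4 * \<beta> * t" and t_ge: "\<alpha> * (norm e)\<^sup>2 \<le> t"
    and \<alpha>\<beta>: "0 < \<alpha>" "0 < \<beta>"
  shows "(norm (e - g *\<^sub>R p + q))\<^sup>2 \<le> (1 - \<gamma> / 2 * (\<alpha> / \<beta>)) * (norm e)\<^sup>2"
    and "g * t \<le> \<gamma> * (norm e)\<^sup>2 / 3"
proof -
  define \<epsilon> where "\<epsilon> = norm e"
  have \<epsilon>: "0 < \<epsilon>" using e by (simp add: \<epsilon>_def)
  define s where "s = g * t"
  have g0: "0 < g" using \<gamma> t N by (simp add: g)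
  have s0: "0 < s" using g0 t by (simp add: s_def)
  have gN: "g\<^sup>2 * N\<^sup>2 = \<gamma> * s" using N by (simp add: g s_def power2_eq_square)
  have s_eq: "s = \<gamma> * (t\<^sup>2 / N\<^sup>2)" by (simp add: s_def g power2_eq_square)
  \<comment> \<open>A lower bound on the projected gradient caps the Polyak step.\<close>
  have "7 / 4 * t \<le> norm p * \<epsilon>" using aim norm_cauchy_schwarz[of p e] by (simp add: \<epsilon>_def)
  also have "\<dots> \<le> N * \<epsilon>" using p_le \<epsilon> by (simp add: mult_right_mono)
  finally have "t \<le> 4 / 7 * (N * \<epsilon>)" by simp
  then have "t\<^sup>2 \<le> (4 / 7 * (N * \<epsilon>))\<^sup>2" using t by (intro power_mono) auto
  then have "t\<^sup>2 \<le> 16 / 49 * (N\<^sup>2 * \<epsilon>\<^sup>2)" by (simp add: power_mult_distrib power_divide)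
  then have "t\<^sup>2 / N\<^sup>2 \<le> 16 / 49 * \<epsilon>\<^sup>2" using N by (simp add: field_simps)
  moreover have "0 < \<epsilon>\<^sup>2" using \<epsilon> by simp
  ultimately have "t\<^sup>2 / N\<^sup>2 \<le> \<epsilon>\<^sup>2 / 3" by linarith
  then have "s \<le> \<gamma> * (\<epsilon>\<^sup>2 / 3)" unfolding s_eq using \<gamma> by (intro mult_left_mono) auto
  then show s_le: "g * t \<le> \<gamma> * (norm e)\<^sup>2 / 3" by (simp add: s_def \<epsilon>_def)
  have s_le': "s \<le> \<epsilon>\<^sup>2 / 3"
  proof -
    have "\<gamma> * (\<epsilon>\<^sup>2 / 3) \<le> 1 * (\<epsilon>\<^sup>2 / 3)" using \<gamma> by (intro mult_right_mono) auto
    then show ?thesis using \<open>s \<le> \<gamma> * (\<epsilon>\<^sup>2 / 3)\<close> by simp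
  qed
  have main: "(norm (e - g *\<^sub>R p))\<^sup>2 \<le> \<epsilon>\<^sup>2 - 5 / 2 * s"
  proof -
    have "(norm (e - g *\<^sub>R p))\<^sup>2 = \<epsilon>\<^sup>2 - 2 * (g * inner p e) + g\<^sup>2 * (norm p)\<^sup>2"
      unfolding \<epsilon>_def power2_norm_eq_inner
      by (simp add: inner_diff_left inner_diff_right inner_commute power2_eq_square)
    moreover have "g * (7 / 4 * t) \<le> g * inner p e" using aim g0 by (intro mult_left_mono) auto
    moreover have "g\<^sup>2 * (norm p)\<^sup>2 \<le> g\<^sup>2 * N\<^sup>2"
      using p_le by (intro mult_left_mono power_mono) auto
    moreover have "\<gamma> * s \<le> s" using \<gamma> s0 by simp
    ultimately show ?thesis using gN by (simp add: s_def)
  qed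
  have "(norm (e - g *\<^sub>R p))\<^sup>2 \<le> \<epsilon>\<^sup>2" using main s0 by linarith
  then have ne: "norm (e - g *\<^sub>R p) \<le> \<epsilon>" using \<epsilon> by (simp add: power2_le_iff_abs_le)
  have q: "norm q \<le> s / (11 * \<epsilon>)" using q_le by (simp add: s_def \<epsilon>_def)
  have 1: "\<epsilon> * norm q \<le> s / 11"
  proof -
    have "\<epsilon> * norm q \<le> \<epsilon> * (s / (11 * \<epsilon>))" using q \<epsilon> by (intro mult_left_mono) auto
    then show ?thesis using \<epsilon> by simp
  qed
  have 2: "(norm q)\<^sup>2 \<le> s / 121"
  proof -
    have "(norm q)\<^sup>2 \<le> (s / (11 * \<epsilon>))\<^sup>2" using q by (intro power_mono) auto
    also have "\<dots> = s * (s / \<epsilon>\<^sup>2) / 121" by (simp add: power2_eq_square)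
    also have "\<dots> \<le> s * 1 / 121"
      using s_le' \<epsilon> s0 by (intro divide_right_mono mult_left_mono) (auto simp: field_simps)
    finally show ?thesis by simp
  qed
  have "norm (e - g *\<^sub>R p + q) \<le> norm (e - g *\<^sub>R p) + norm q" by (rule norm_triangle_ineq)
  then have "(norm (e - g *\<^sub>R p + q))\<^sup>2 \<le> (norm (e - g *\<^sub>R p) + norm q)\<^sup>2"
    by (intro power_mono) auto
  also have "\<dots> = (norm (e - g *\<^sub>R p))\<^sup>2 + 2 * (norm (e - g *\<^sub>R p) * norm q) + (norm q)\<^sup>2"
    by (simp add: power2_sum)
  also have "\<dots> \<le> (\<epsilon>\<^sup>2 - 5 / 2 * s) + 2 * (\<epsilon> * norm q) + (norm q)\<^sup>2"
    using main ne by (intro add_mono mult_left_mono mult_right_mono) auto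
  also have "\<dots> \<le> \<epsilon>\<^sup>2 - 2 * s" using 1 2 s0 by linarith
  also have "\<dots> \<le> \<epsilon>\<^sup>2 - \<gamma> / 2 * (\<alpha> / \<beta>) * \<epsilon>\<^sup>2"
  proof -
    have "\<alpha> * \<epsilon>\<^sup>2 / (4 * \<beta>) \<le> t / (4 * \<beta>)"
      using t_ge \<alpha>\<beta> by (intro divide_right_mono) (auto simp: \<epsilon>_def)
    also have "\<dots> = t\<^sup>2 / (4 * \<beta> * t)" using t by (simp add: power2_eq_square)
    also have "\<dots> \<le> t\<^sup>2 / N\<^sup>2" using N_le N t \<alpha>\<beta> by (intro divide_left_mono) auto
    finally have "\<gamma> * (\<alpha> * \<epsilon>\<^sup>2 / (4 * \<beta>)) \<le> s"
      unfolding s_eq using \<gamma> by (intro mult_left_mono) auto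
    moreover have "\<gamma> / 2 * (\<alpha> / \<beta>) * \<epsilon>\<^sup>2 = 2 * (\<gamma> * (\<alpha> * \<epsilon>\<^sup>2 / (4 * \<beta>)))" by simp
    ultimately show ?thesis by linarith
  qed
  finally show "(norm (e - g *\<^sub>R p + q))\<^sup>2 \<le> (1 - \<gamma> / 2 * (\<alpha> / \<beta>)) * (norm e)\<^sup>2"
    by (simp add: \<epsilon>_def algebra_simps)
qed

text \<open>One step of the method. With \<open>J\<close> the derivative and \<open>d\<close> the damped solution for the gradient \<open>v\<close>, the
  new error is \<open>e - g J d\<close> plus \<open>g\<^sup>2\<close> times the product of the two components of \<open>d\<close>. Symmetry gives
  \<open>\<langle>J d, e\<rangle> = \<langle>v, e\<rangle> - \<langle>v, w\<rangle>\<close>, where \<open>w\<close> is the part of \<open>e\<close> missed by the damped projection; it is small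
  because \<open>tangent_approximation\<close> provides a competitor \<open>u\<close> and the damping is at most \<open>Cub * norm e\<close>. The
  product term is small because the damping is at least \<open>Clb * norm e\<close>, which limits the length of \<open>d\<close>.
  All matrices to which \<open>A\<close> is applied are built from \<open>e\<close> and the range of \<open>J\<close>, hence have rank at most
  \<open>4 r\<close>, so that the restricted isometry bounds \<open>A\<close> on them.\<close>

lemma lmm_step_contracts:
  fixes X Xs :: "real^'r^'d1" and Y Ys :: "real^'r^'d2" and p :: "real^'r^'r"
    and A :: "real^'d2^'d1 \<Rightarrow> real^'m"
    and F :: "(real^'r^'d1) \<times> (real^'r^'d2) \<Rightarrow> real^'d2^'d1"
  assumes F_def: "F = (\<lambda>(U, V). U ** transpose V)"
    and h_def: "h = (\<lambda>Z. (norm (A Z - A (Xs ** transpose Ys)))\<^sup>2)"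
    and p: "orthogonal_projection p" and Xsp: "Xs ** p = Xs" and Ysp: "Ys ** p = Ys"
    and \<mu>: "0 < \<mu>"
    and lowerX: "\<And>a. \<mu> * norm (p *v a) \<le> norm (Xs *v a)"
    and lowerY: "\<And>a. \<mu> * norm (p *v a) \<le> norm (Ys *v a)"
    and closeX: "norm (X - Xs) \<le> \<mu> / 40" and closeY: "norm (Y - Ys) \<le> \<mu> / 40"
    and A: "linear A"
    and \<alpha>\<beta>: "0 < \<alpha>" "\<alpha> \<le> \<beta>" and \<rho>_def: "\<rho> = \<alpha> / \<beta>"
    and rip: "\<And>Z. rank Z \<le> 6 * CARD('r) \<Longrightarrow>
        \<alpha> * (norm Z)\<^sup>2 \<le> (norm (A Z))\<^sup>2 \<and> (norm (A Z))\<^sup>2 \<le> \<beta> * (norm Z)\<^sup>2"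
    and e_def: "e = X ** transpose Y - Xs ** transpose Ys"
    and e0: "e \<noteq> 0" and e_small: "norm e \<le> \<rho> / 100 * \<mu>\<^sup>2"
    and \<gamma>: "0 < \<gamma>" "\<gamma> \<le> 1" "\<gamma> \<le> Clb / sqrt 2" and Clb: "0 < Clb"
    and l: "Clb * norm e \<le> l" "l \<le> Cub * norm e"
    and Cub: "Cub * (100 * (real (rank (mat 1 - p)) + 1)) \<le> \<rho>\<^sup>2 / 70"
    and g: "0 < g" "g = \<gamma> * (h (F (X, Y)) /
        (norm (range_projection F (X, Y) (gradient h (F (X, Y)))))\<^sup>2)"
  shows "(norm (F (lmm_step h F g l (X, Y)) - Xs ** transpose Ys))\<^sup>2
      \<le> (1 - \<gamma> / 2 * \<rho>) * (norm e)\<^sup>2"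
    and "(norm (lmm_step h F g l (X, Y) - (X, Y)))\<^sup>2 \<le> \<gamma>\<^sup>2 * norm e / (12 * Clb)"
proof -
  define \<epsilon> where "\<epsilon> = norm e"
  have \<epsilon>: "0 < \<epsilon>" using e0 by (simp add: \<epsilon>_def)
  have \<rho>: "0 < \<rho>" "\<rho> \<le> 1" using \<alpha>\<beta> by (auto simp: \<rho>_def)
  have l0: "0 < l" using l(1) Clb e0 by (smt (verit) mult_pos_pos zero_less_norm_iff)
  define J :: "(real^'r^'d1) \<times> (real^'r^'d2) \<Rightarrow> real^'d2^'d1"
    where "J = (\<lambda>(U, V). U ** transpose Y + X ** transpose V)"
  have dF: "derivative F (X, Y) = J"
    unfolding F_def J_def by (rule derivative_mult_transpose)
  have J: "linear J"
    unfolding J_def by (rule linearI) (auto simp: matrix_distribs transpose_distribs algebra_simps)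
  have rankJ: "rank (J u) \<le> 2 * CARD('r)" for u
  proof -
    have "rank (J u) \<le> rank (fst u ** transpose Y) + rank (X ** transpose (snd u))"
      unfolding J_def case_prod_beta' by (rule rank_add_le)
    then show ?thesis
      using rank_mult_inner_dim[of "fst u" "transpose Y"] rank_mult_inner_dim[of X "transpose (snd u)"] by simp
  qed
  have ranke: "rank e \<le> 2 * CARD('r)"
    using rank_diff_le[of "X ** transpose Y" "Xs ** transpose Ys"]
      rank_mult_inner_dim[of X "transpose Y"] rank_mult_inner_dim[of Xs "transpose Ys"] by (simp add: e_def)
  define v where "v = gradient h (F (X, Y))"
  define t where "t = (norm (A e))\<^sup>2"
  have Ae: "A (X ** transpose Y) - A (Xs ** transpose Ys) = A e"
    by (simp add: e_def linear_diff[OF A])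
  have hF: "h (F (X, Y)) = t" by (simp add: h_def F_def t_def Ae)
  have v: "inner v w = 2 * inner (A e) (A w)" for w
    unfolding v_def h_def gradient_least_squares[OF A]
    by (simp add: F_def Ae adjoint_clauses(2)[OF A])
  have t_ge: "\<alpha> * \<epsilon>\<^sup>2 \<le> t"
    using rip[of e] ranke by (simp add: t_def \<epsilon>_def)
  then have t: "0 < t" using \<alpha>\<beta> \<epsilon> by (smt (verit) mult_pos_pos zero_less_power)
  define P where "P = closest_point (range J) v"
  define N where "N = norm P"
  have P_eq: "range_projection F (X, Y) (gradient h (F (X, Y))) = P"
    by (simp add: range_projection_def dF P_def v_def)
  have g_eq: "g = \<gamma> * (t / N\<^sup>2)" using g(2) by (simp add: hF P_eq N_def)
  then have N: "0 < N" using g(1) by (cases "N = 0") (auto simp: N_def)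
  have subJ: "subspace (range J)" using J by (simp add: linear_subspace_image)
  have cauchy: "(inner (A e) (A w))\<^sup>2 \<le> t * (\<beta> * (norm w)\<^sup>2)" if "rank w \<le> 6 * CARD('r)" for w
  proof -
    have "(inner (A e) (A w))\<^sup>2 \<le> t * (norm (A w))\<^sup>2"
      using Cauchy_Schwarz_ineq[of "A e" "A w"] by (simp add: t_def power2_norm_eq_inner)
    also have "\<dots> \<le> t * (\<beta> * (norm w)\<^sup>2)" using rip[OF that] t by (intro mult_left_mono) auto
    finally show ?thesis .
  qed
  have N_le: "N\<^sup>2 \<le> 4 * \<beta> * t"
  proof -
    have PJ: "P \<in> range J" unfolding P_def by (rule closest_point_subspace(1)[OF subJ])
    then obtain u where "P = J u" by blast
    then have "rank P \<le> 6 * CARD('r)" using rankJ[of u] by simp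
    note c = cauchy[OF this]
    have "N\<^sup>2 = inner P P" by (simp add: N_def power2_norm_eq_inner)
    also have "\<dots> = inner v P" using closest_point_subspace(2)[OF subJ PJ, of v] by (simp add: P_def)
    finally have "N\<^sup>2 = 2 * inner (A e) (A P)" by (simp add: v)
    then have "(N\<^sup>2)\<^sup>2 = 4 * (inner (A e) (A P))\<^sup>2" by (simp only: power_mult_distrib) simp
    then have "(N\<^sup>2)\<^sup>2 \<le> 4 * (t * (\<beta> * N\<^sup>2))" using c unfolding N_def by linarith
    then have "N\<^sup>2 * N\<^sup>2 \<le> (4 * \<beta> * t) * N\<^sup>2" by (simp add: power2_eq_square mult_ac)
    then show ?thesis using N by (simp only: mult_le_cancel_right) auto
  qed
  define d where "d = damped_solution J l v"
  define w where "w = e - J (damped_solution J l e)"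
  (* The residual and the damping contribute 1/10000 + 1/70, which is below 1/64. *)
  have w_small: "(norm w)\<^sup>2 \<le> \<rho>\<^sup>2 / 64 * \<epsilon>\<^sup>2"
  proof -
    have "\<rho> / 100 * \<mu>\<^sup>2 \<le> 1 / 2 * \<mu>\<^sup>2" using \<rho> by (intro mult_right_mono) auto
    then have e_small2: "norm e \<le> \<mu>\<^sup>2 / 2" using e_small by simp
    obtain U V where UV: "norm (e - (U ** transpose Y + X ** transpose V)) \<le> (norm e)\<^sup>2 / \<mu>\<^sup>2"
      "(norm (U, V))\<^sup>2 \<le> 100 * (real (rank (mat 1 - p)) + 1) * norm e"
      using tangent_approximation[OF p Xsp Ysp \<mu> lowerX lowerY closeX closeY e_def e_small2] by metis
    have "(norm w)\<^sup>2 \<le> (norm (e - J (U, V)))\<^sup>2 + l * (norm (U, V))\<^sup>2"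
      unfolding w_def by (rule damped_solution_optimal[OF J l0])
    moreover have "(norm (e - J (U, V)))\<^sup>2 \<le> \<rho>\<^sup>2 / 10000 * \<epsilon>\<^sup>2"
    proof -
      have "norm (e - J (U, V)) \<le> \<epsilon> * (\<epsilon> / \<mu>\<^sup>2)" using UV(1) by (simp add: J_def \<epsilon>_def power2_eq_square)
      also have "\<dots> \<le> \<epsilon> * (\<rho> / 100)"
        using e_small \<mu> \<epsilon> by (intro mult_left_mono) (auto simp: \<epsilon>_def field_simps)
      finally have "(norm (e - J (U, V)))\<^sup>2 \<le> (\<epsilon> * (\<rho> / 100))\<^sup>2" by (intro power_mono) auto
      then show ?thesis by (simp add: power_mult_distrib power_divide mult_ac)
    qed
    moreover have "l * (norm (U, V))\<^sup>2 \<le> \<rho>\<^sup>2 / 70 * \<epsilon>\<^sup>2"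
    proof -
      have "l * (norm (U, V))\<^sup>2 \<le> (Cub * \<epsilon>) * (100 * (real (rank (mat 1 - p)) + 1) * \<epsilon>)"
        using l UV(2) l0 by (intro mult_mono) (auto simp: \<epsilon>_def)
      also have "\<dots> = (Cub * (100 * (real (rank (mat 1 - p)) + 1))) * \<epsilon>\<^sup>2"
        by (simp add: power2_eq_square)
      also have "\<dots> \<le> \<rho>\<^sup>2 / 70 * \<epsilon>\<^sup>2" using Cub by (intro mult_right_mono) auto
      finally show ?thesis .
    qed
    moreover have "0 \<le> \<rho>\<^sup>2 * \<epsilon>\<^sup>2" by simp
    ultimately show ?thesis unfolding times_divide_eq_left by linarith
  qed
  have vw: "inner v w \<le> t / 4"
  proof -
    have "rank w \<le> 6 * CARD('r)"
      using rank_diff_le[of e "J (damped_solution J l e)"] ranke rankJ[of "damped_solution J l e"]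
      by (simp add: w_def)
    then have "(inner (A e) (A w))\<^sup>2 \<le> t * (\<beta> * (norm w)\<^sup>2)" by (rule cauchy)
    also have "\<dots> \<le> t * (\<beta> * (\<rho>\<^sup>2 / 64 * \<epsilon>\<^sup>2))"
      using w_small t \<alpha>\<beta> by (intro mult_left_mono) auto
    also have "\<dots> = t * (\<rho> / 64) * (\<alpha> * \<epsilon>\<^sup>2)"
      using \<alpha>\<beta> by (simp add: \<rho>_def power2_eq_square)
    also have "\<dots> \<le> t * (1 / 64) * t" using t_ge t \<rho> \<alpha>\<beta> by (intro mult_mono) auto
    also have "\<dots> = (t / 8)\<^sup>2" by (simp add: power2_eq_square)
    finally have "\<bar>inner (A e) (A w)\<bar> \<le> t / 8" using t by (simp add: power2_le_iff_abs_le)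
    then show ?thesis by (simp add: v)
  qed
  have aim: "7 / 4 * t \<le> inner (J d) e"
  proof -
    have "inner (J d) e = inner v (J (damped_solution J l e))"
      unfolding d_def by (rule damped_solution_symmetric[OF J l0])
    also have "\<dots> = inner v e - inner v w" by (simp add: w_def inner_diff_right)
    also have "inner v e = 2 * t" by (simp add: v t_def power2_norm_eq_inner)
    finally show ?thesis using vw by simp
  qed
  have Jd: "norm (J d) \<le> N" and d_le: "4 * l * (norm d)\<^sup>2 \<le> N\<^sup>2"
    unfolding d_def N_def P_def by (rule damped_solution_bounds[OF J l0])+
  have gN: "g\<^sup>2 * N\<^sup>2 = \<gamma> * (g * t)" using N by (simp add: g_eq power2_eq_square)
  have gd: "g\<^sup>2 * (norm d)\<^sup>2 \<le> \<gamma> * (g * t) / (4 * (Clb * \<epsilon>))"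
  proof -
    have "g\<^sup>2 * (4 * l * (norm d)\<^sup>2) \<le> g\<^sup>2 * N\<^sup>2" using d_le by (intro mult_left_mono) auto
    then have "g\<^sup>2 * (norm d)\<^sup>2 \<le> \<gamma> * (g * t) / (4 * l)" using l0 gN by (simp add: field_simps)
    also have "\<dots> \<le> \<gamma> * (g * t) / (4 * (Clb * \<epsilon>))"
      using l(1) l0 \<gamma> g(1) t Clb \<epsilon> by (intro divide_left_mono) (auto simp: \<epsilon>_def)
    finally show ?thesis .
  qed
  have step: "lmm_step h F g l (X, Y) = (X, Y) - g *\<^sub>R d"
    by (simp add: lmm_step_def dF d_def damped_solution_def v_def)
  define q where "q = g\<^sup>2 *\<^sub>R (fst d ** transpose (snd d))"
  have Fstep: "F (lmm_step h F g l (X, Y)) - Xs ** transpose Ys = e - g *\<^sub>R J d + q"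
    unfolding step by (cases d) (simp add: F_def J_def q_def e_def matrix_distribs transpose_distribs
        scaleR_add_right scaleR_diff_right power2_eq_square)
  (* The damping and the bound on \<gamma> give the factor 8 sqrt 2, which exceeds 11. *)
  have q_le: "norm q \<le> g * t / (11 * norm e)"
  proof -
    have "0 \<le> (norm (fst d) - norm (snd d))\<^sup>2" by simp
    then have "2 * (norm (fst d) * norm (snd d)) \<le> (norm d)\<^sup>2"
      by (simp add: norm_prod_def power2_diff)
    then have "norm (fst d ** transpose (snd d)) \<le> (norm d)\<^sup>2 / 2"
      using norm_mult_le[of "fst d" "transpose (snd d)"] by simp
    then have "g\<^sup>2 * norm (fst d ** transpose (snd d)) \<le> g\<^sup>2 * ((norm d)\<^sup>2 / 2)"
      by (intro mult_left_mono) auto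
    then have "norm q \<le> g\<^sup>2 * ((norm d)\<^sup>2 / 2)" by (simp add: q_def)
    also have "\<dots> \<le> \<gamma> * (g * t) / (4 * (Clb * \<epsilon>)) / 2" using gd by simp
    also have "\<dots> = (\<gamma> / Clb) * (g * t / (8 * \<epsilon>))" by simp
    also have "\<dots> \<le> 8 / 11 * (g * t / (8 * \<epsilon>))"
    proof (intro mult_right_mono)
      have "(11 / 8)\<^sup>2 \<le> (sqrt 2)\<^sup>2" by (simp add: power2_eq_square)
      then have "11 / 8 \<le> sqrt 2" by (rule power2_le_imp_le) simp
      then have "Clb / sqrt 2 \<le> Clb / (11 / 8)" using Clb by (intro divide_left_mono) auto
      then have "\<gamma> \<le> Clb / (11 / 8)" using \<gamma>(3) by linarith
      then show "\<gamma> / Clb \<le> 8 / 11" using Clb by (simp add: field_simps)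
    qed (use g(1) t \<epsilon> in auto)
    finally show ?thesis by (simp add: \<epsilon>_def)
  qed
  note c = polyak_contraction[OF \<gamma>(1,2) N t e0 g_eq Jd aim q_le N_le t_ge[unfolded \<epsilon>_def] \<alpha>\<beta>(1)]
  show "(norm (F (lmm_step h F g l (X, Y)) - Xs ** transpose Ys))\<^sup>2
      \<le> (1 - \<gamma> / 2 * \<rho>) * (norm e)\<^sup>2"
    unfolding Fstep \<rho>_def using c(1) \<alpha>\<beta> by simp
  have "(norm (lmm_step h F g l (X, Y) - (X, Y)))\<^sup>2 = g\<^sup>2 * (norm d)\<^sup>2"
    by (simp add: step power_mult_distrib)
  also have "\<dots> \<le> \<gamma> * (g * t) / (4 * (Clb * \<epsilon>))" by (rule gd)
  also have "\<dots> \<le> \<gamma> * (\<gamma> * \<epsilon>\<^sup>2 / 3) / (4 * (Clb * \<epsilon>))"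
    using c(2) \<alpha>\<beta> \<gamma> Clb \<epsilon> by (intro divide_right_mono mult_left_mono) (auto simp: \<epsilon>_def)
  also have "\<dots> = \<gamma>\<^sup>2 * norm e / (12 * Clb)"
    using \<epsilon> Clb by (simp add: power2_eq_square \<epsilon>_def[symmetric])
  finally show "(norm (lmm_step h F g l (X, Y) - (X, Y)))\<^sup>2 \<le> \<gamma>\<^sup>2 * norm e / (12 * Clb)" .
qed

section \<open>Singular value decompositions\<close>

lemma inj_pos: "inj (pos :: 'n::finite \<Rightarrow> nat)"
  unfolding pos_def using to_nat_on_finite[of "UNIV :: 'n set"]
  by (simp add: bij_betw_def inj_on_def)

lemma pos_eq_iff: "pos (i :: 'n::finite) = pos j \<longleftrightarrow> i = j"
  using inj_pos by (auto simp: inj_on_def)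

lemma range_pos: "range (pos :: 'n::finite \<Rightarrow> nat) = {1..CARD('n)}"
proof -
  have "range (to_nat_on (UNIV :: 'n set)) = {..<CARD('n)}"
    using to_nat_on_finite[of "UNIV :: 'n set"] by (simp add: bij_betw_def)
  then have "Suc ` range (to_nat_on (UNIV :: 'n set)) = {1..CARD('n)}"
    by (simp add: lessThan_atLeast0 image_Suc_atLeastLessThan atLeastLessThanSuc_atLeastAtMost)
  then show ?thesis by (simp add: pos_def[abs_def] image_image)
qed

lemma ex_pos: "1 \<le> k \<Longrightarrow> k \<le> CARD('n) \<Longrightarrow> \<exists>i :: 'n::finite. pos i = k"
  using range_pos[where 'n = 'n] by (metis atLeastAtMost_iff imageE)

lemma pos_bounds: "1 \<le> pos (i :: 'n::finite)" "pos (i :: 'n::finite) \<le> CARD('n)"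
  using range_pos[where 'n = 'n] by (auto simp: set_eq_iff)

text \<open>The squared length of a column of the middle factor of a decomposition is the square of the
  corresponding singular value. Unlike a diagonal entry it also makes sense, with value 0, for the
  columns beyond the end of the diagonal of a wide matrix.\<close>

definition col_sq :: "real^'n^'m \<Rightarrow> 'n \<Rightarrow> real" where
  "col_sq S j = (\<Sum>i\<in>UNIV. (S $ i $ j)\<^sup>2)"

context
  fixes A :: "real^'n^'m" and U S V
  assumes svd: "is_svd A U S V"
begin

lemma svd_off_diagonal: "pos i \<noteq> pos j \<Longrightarrow> S $ i $ j = 0"
  and svd_nonneg: "pos i = pos j \<Longrightarrow> 0 \<le> S $ i $ j"
  and svd_antimono: "pos i = pos j \<Longrightarrow> pos i' = pos j' \<Longrightarrow> pos i \<le> pos i' \<Longrightarrow> S $ i' $ j' \<le> S $ i $ j"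
  using svd unfolding is_svd_def by blast+

lemma svd_orthogonal: "orthogonal_matrix U" "orthogonal_matrix V"
  using svd unfolding is_svd_def by blast+

lemma col_sq_eq: "pos i = pos j \<Longrightarrow> col_sq S j = (S $ i $ j)\<^sup>2"
proof -
  assume ij: "pos i = pos j"
  have "col_sq S j = (\<Sum>i'\<in>UNIV. if i' = i then (S $ i $ j)\<^sup>2 else 0)"
    unfolding col_sq_def
  proof (rule sum.cong[OF refl])
    fix i'
    show "(S $ i' $ j)\<^sup>2 = (if i' = i then (S $ i $ j)\<^sup>2 else 0)"
      using ij svd_off_diagonal[of i' j] pos_eq_iff[of i' i] by auto
  qed
  then show ?thesis by simp
qed

lemma col_sq_eq_0: "\<nexists>i :: 'm. pos i = pos j \<Longrightarrow> col_sq S j = 0"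
  unfolding col_sq_def by (rule sum.neutral) (use svd_off_diagonal in force)

text \<open>In coordinates with respect to the right singular vectors the matrix acts diagonally; the comparison
  lemmas that follow are read off from this formula.\<close>

lemma norm_svd: "(norm (A *v a))\<^sup>2 = (\<Sum>j\<in>UNIV. col_sq S j * ((transpose V *v a) $ j)\<^sup>2)"
proof -
  define b where "b = transpose V *v a"
  have "A *v a = U *v (S *v b)"
    using svd by (simp add: is_svd_def b_def matrix_vector_mul_assoc matrix_mul_assoc
        del: transpose_matrix_vector)
  then have "norm (A *v a) = norm (S *v b)"
    using svd_orthogonal(1) by (simp add: orthogonal_transformation_matrix
        orthogonal_transformation_norm[of "(*v) U"])
  moreover have "((S *v b) $ i)\<^sup>2 = (\<Sum>j\<in>UNIV. (S $ i $ j)\<^sup>2 * (b $ j)\<^sup>2)" for i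
  proof (cases "\<exists>j :: 'n. pos j = pos i")
    case True
    then obtain j0 :: 'n where j0: "pos j0 = pos i" by blast
    have S: "S $ i $ j = (if j = j0 then S $ i $ j0 else 0)" for j
      using j0 svd_off_diagonal[of i j] pos_eq_iff[of j j0] by auto
    have "(S *v b) $ i = (\<Sum>j\<in>UNIV. if j = j0 then S $ i $ j0 * b $ j0 else 0)"
      unfolding matrix_vector_mult_def vec_lambda_beta
      by (rule sum.cong[OF refl], subst S, simp)
    moreover have "(\<Sum>j\<in>UNIV. (S $ i $ j)\<^sup>2 * (b $ j)\<^sup>2)
        = (\<Sum>j\<in>UNIV. if j = j0 then (S $ i $ j0 * b $ j0)\<^sup>2 else 0)"
      by (rule sum.cong[OF refl], subst S, simp add: power_mult_distrib)
    ultimately show ?thesis by simp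
  next
    case False
    then have "S $ i $ j = 0" for j using svd_off_diagonal[of i j] by metis
    then show ?thesis by (simp add: matrix_vector_mult_def)
  qed
  then have "(norm (S *v b))\<^sup>2 = (\<Sum>i\<in>UNIV. \<Sum>j\<in>UNIV. (S $ i $ j)\<^sup>2 * (b $ j)\<^sup>2)"
    unfolding power2_norm_eq_inner inner_vec_def by (simp add: power2_eq_square[symmetric])
  then have "(norm (S *v b))\<^sup>2 = (\<Sum>j\<in>UNIV. col_sq S j * (b $ j)\<^sup>2)"
    by (subst (asm) sum.swap) (simp add: col_sq_def sum_distrib_right)
  ultimately show ?thesis by (simp add: b_def)
qed

lemma norm_transpose_V: "norm (transpose V *v a) = norm a"
  using svd_orthogonal(2)
  by (metis orthogonal_matrix_transpose orthogonal_transformation_matrix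
      orthogonal_transformation_norm matrix_of_matrix_vector_mul matrix_vector_mul_linear)

lemma norm_sq_coords: "(norm a)\<^sup>2 = (\<Sum>j\<in>UNIV. ((transpose V *v a) $ j)\<^sup>2)"
  unfolding norm_transpose_V[of a, symmetric] power2_norm_eq_inner inner_vec_def
  by (simp add: power2_eq_square)

lemma col_sq_antimono: "pos j \<le> pos j' \<Longrightarrow> col_sq S j' \<le> col_sq S j"
proof (cases "\<exists>i' :: 'm. pos i' = pos j'")
  case True
  assume le: "pos j \<le> pos j'"
  then obtain i' :: 'm where i': "pos i' = pos j'" using True by blast
  obtain i :: 'm where i: "pos i = pos j"
    using ex_pos[of "pos j", where 'n = 'm] pos_bounds[of j] pos_bounds[of i'] le i' by auto
  show ?thesis
    using svd_antimono[OF i i'] svd_nonneg[OF i'] le i i' by (simp add: col_sq_eq[OF i] col_sq_eq[OF i'] power_mono)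
next
  case False
  then have "col_sq S j' = 0" by (rule col_sq_eq_0)
  then show ?thesis by (simp add: col_sq_def sum_nonneg)
qed

lemma svd_upper:
  assumes "\<And>l. pos l < pos j \<Longrightarrow> (transpose V *v a) $ l = 0"
  shows "(norm (A *v a))\<^sup>2 \<le> col_sq S j * (norm a)\<^sup>2"
  unfolding norm_svd norm_sq_coords sum_distrib_left
proof (rule sum_mono)
  fix l
  show "col_sq S l * ((transpose V *v a) $ l)\<^sup>2 \<le> col_sq S j * ((transpose V *v a) $ l)\<^sup>2"
  proof (cases "pos l < pos j")
    case False then show ?thesis by (intro mult_right_mono col_sq_antimono) auto
  next
    case True then have "(transpose V *v a) $ l = 0" by (rule assms)
    then show ?thesis by (simp only:) simp
  qed
qed

lemma svd_lower:
  assumes "\<And>l. pos j < pos l \<Longrightarrow> (transpose V *v a) $ l = 0"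
  shows "col_sq S j * (norm a)\<^sup>2 \<le> (norm (A *v a))\<^sup>2"
  unfolding norm_svd norm_sq_coords sum_distrib_left
proof (rule sum_mono)
  fix l
  show "col_sq S j * ((transpose V *v a) $ l)\<^sup>2 \<le> col_sq S l * ((transpose V *v a) $ l)\<^sup>2"
  proof (cases "pos j < pos l")
    case False then show ?thesis by (intro mult_right_mono col_sq_antimono) auto
  next
    case True then have "(transpose V *v a) $ l = 0" by (rule assms)
    then show ?thesis by (simp only:) simp
  qed
qed

end

text \<open>The Courant-Fischer argument for the uniqueness of singular values. Being orthogonal to the right
  singular vectors before \<open>j\<close> of one decomposition and to those after \<open>j\<close> of another one are together one
  linear condition fewer than there are coordinates, so some nonzero vector satisfies them all; it is
  stretched by at most the \<open>j\<close>-th singular value of the first and by at least that of the second.\<close>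

lemma col_sq_unique_le:
  fixes A :: "real^'n^'m"
  assumes svd: "is_svd A U S V" and svd': "is_svd A U' S' V'"
  shows "col_sq S' j \<le> col_sq S j"
proof -
  define M :: "real^'n^'n" where
    "M = (\<chi> l. if pos l < pos j then column l V else if pos j < pos l then column l V' else 0)"
  have "row j M = 0" by (simp add: M_def row_def vec_eq_iff)
  then have "det M = 0" by (rule det_zero_row)
  then obtain a where a: "a \<noteq> 0" "M *v a = 0"
    using matrix_nonfull_linear_equations_eq[of M] det_eq_0_rank[of M] by auto
  have Ma: "inner (M $ l) a = 0" for l
    using a(2) by (metis matrix_vector_mul_component zero_index)
  have "(transpose V *v a) $ l = 0" if "pos l < pos j" for l
    using Ma[of l] that
    by (simp only: M_def vec_lambda_beta if_True matrix_vector_mul_component)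
      (simp add: column_def transpose_def)
  then have 1: "(norm (A *v a))\<^sup>2 \<le> col_sq S j * (norm a)\<^sup>2" by (intro svd_upper[OF svd])
  have "(transpose V' *v a) $ l = 0" if "pos j < pos l" for l
    using Ma[of l] that
    by (simp only: M_def vec_lambda_beta matrix_vector_mul_component)
      (simp add: column_def transpose_def)
  then have 2: "col_sq S' j * (norm a)\<^sup>2 \<le> (norm (A *v a))\<^sup>2" by (intro svd_lower[OF svd'])
  show ?thesis using order_trans[OF 2 1] a(1) by simp
qed

lemma singular_value_eq:
  fixes A :: "real^'n^'m"
  assumes svd: "is_svd A U S V" and i: "pos i = k" and j: "pos j = k"
  shows "singular_value A k = S $ i $ j"
  unfolding singular_value_def
proof (rule the_equality)
  show "\<exists>U S' V i' j'. is_svd A U S' V \<and> pos i' = k \<and> pos j' = k \<and> S $ i $ j = S' $ i' $ j'"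
    using assms by blast
next
  fix s assume "\<exists>U S V i j. is_svd A U S V \<and> pos i = k \<and> pos j = k \<and> s = S $ i $ j"
  then obtain U' S' V' i' j' where *: "is_svd A U' S' V'" "pos i' = k" "pos j' = k" "s = S' $ i' $ j'"
    by blast
  have [simp]: "i' = i" "j' = j" using * i j pos_eq_iff by metis+
  have ij: "pos i = pos j" using i j by simp
  have "col_sq S' j = col_sq S j"
    using col_sq_unique_le[OF svd *(1)] col_sq_unique_le[OF *(1) svd] by (rule antisym)
  then have "(S' $ i $ j)\<^sup>2 = (S $ i $ j)\<^sup>2"
    by (simp add: col_sq_eq[OF svd ij] col_sq_eq[OF *(1) ij])
  then show "s = S $ i $ j"
    using svd_nonneg[OF svd ij] svd_nonneg[OF *(1) ij] *(4) by simp
qed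

text \<open>The kernel consists of the vectors whose coordinates vanish at all nonzero singular values, so the
  dimension formula gives exactly \<open>rank A\<close> nonzero ones; as singular values decrease, these come first.\<close>

lemma col_sq_nonzero_iff:
  fixes A :: "real^'n^'m"
  assumes svd: "is_svd A U S V"
  shows "col_sq S j \<noteq> 0 \<longleftrightarrow> pos j \<le> rank A"
proof -
  let ?D = "{j. col_sq S j \<noteq> 0}"
  have nonneg: "0 \<le> col_sq S j" for j by (simp add: col_sq_def sum_nonneg)
  have "A *v a = 0 \<longleftrightarrow> (\<forall>j. j \<notin> - ?D \<longrightarrow> (transpose V *v a) $ j = 0)" for a
  proof -
    have "A *v a = 0 \<longleftrightarrow> (norm (A *v a))\<^sup>2 = 0" by simp
    also have "\<dots> \<longleftrightarrow> (\<forall>j. col_sq S j * ((transpose V *v a) $ j)\<^sup>2 = 0)"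
      unfolding norm_svd[OF svd] by (subst sum_nonneg_eq_0_iff) (auto simp: nonneg)
    finally show ?thesis by auto
  qed
  then have ker: "{a. A *v a = 0} = {a. \<forall>j. j \<notin> - ?D \<longrightarrow> (transpose V *v a) $ j = 0}" by blast
  have "(*v) (transpose V) ` {a. A *v a = 0} = {b. \<forall>j. j \<notin> - ?D \<longrightarrow> b $ j = 0}" (is "?L = ?R")
  proof (intro equalityI subsetI)
    fix b assume b: "b \<in> ?R"
    have Vb: "transpose V *v (V *v b) = b"
      using svd_orthogonal(2)[OF svd]
      by (simp add: matrix_vector_mul_assoc orthogonal_matrix_def del: transpose_matrix_vector)
    show "b \<in> ?L"
      unfolding ker by (rule image_eqI[of _ _ "V *v b"]) (use b Vb in \<open>auto simp del: transpose_matrix_vector\<close>)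
  qed (auto simp: ker)
  moreover have "inj ((*v) (transpose V))"
    using norm_transpose_V[OF svd]
    by (intro linear_injective_0[THEN iffD2] allI impI matrix_vector_mul_linear) (metis norm_eq_zero)
  then have "dim ((*v) (transpose V) ` {a. A *v a = 0}) = dim {a. A *v a = 0}"
    by (intro dim_image_eq) (auto simp: inj_on_def)
  ultimately have "dim {a. A *v a = 0} = dim ?R" by simp
  also have "\<dots> = vec.dim ?R" by (simp only: dim_vec_eq)
  also have "\<dots> = card (- ?D)" by (rule dim_substandard_cart)
  finally have kerdim: "dim {a. A *v a = 0} = card (- ?D)" .
  have "dim {y \<in> UNIV. \<forall>x\<in>span (rows A). orthogonal x y} + dim (span (rows A)) = dim (UNIV :: (real^'n) set)"
    by (rule dim_subspace_orthogonal_to_vectors) auto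
  moreover have "{y \<in> UNIV. \<forall>x\<in>span (rows A). orthogonal x y} = {a. A *v a = 0}"
  proof -
    have "(\<forall>x\<in>span (rows A). orthogonal x y) \<longleftrightarrow> (\<forall>i. inner (A $ i) y = 0)" for y
    proof
      assume "\<forall>i. inner (A $ i) y = 0"
      then have "rows A \<subseteq> {x. inner y x = 0}" by (auto simp: rows_def row_def inner_commute)
      then have "span (rows A) \<subseteq> {x. inner y x = 0}"
        by (rule span_minimal[OF _ subspace_hyperplane])
      then show "\<forall>x\<in>span (rows A). orthogonal x y"
        by (auto simp: orthogonal_def inner_commute)
    next
      assume "\<forall>x\<in>span (rows A). orthogonal x y"
      moreover have "A $ i \<in> span (rows A)" for i
        by (intro span_base) (auto simp: rows_def row_def)
      ultimately show "\<forall>i. inner (A $ i) y = 0" by (auto simp: orthogonal_def)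
    qed
    then show ?thesis by (simp add: vec_eq_iff matrix_vector_mul_component)
  qed
  ultimately have "dim {a. A *v a = 0} + rank A = CARD('n)"
    by (simp add: row_rank_def)
  then have rank: "card ?D = rank A"
    using kerdim card_Un_disjoint[of ?D "- ?D"] by (simp add: rank_dim_range Compl_partition)
  have "card ?D = card (pos ` ?D)" using inj_pos by (metis card_image inj_on_subset top_greatest)
  moreover have "pos ` ?D = {1..card (pos ` ?D)}"
  proof -
    have down: "k \<in> pos ` ?D" if mem: "k' \<in> pos ` ?D" "1 \<le> k" "k \<le> k'" for k k'
    proof -
      obtain j' where j': "k' = pos j'" "col_sq S j' \<noteq> 0" using mem(1) by blast
      obtain j :: 'n where j: "pos j = k"
        using ex_pos[of k, where 'n = 'n] mem j' pos_bounds(2)[of j'] by auto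
      have "col_sq S j' \<le> col_sq S j" using mem j j' by (intro col_sq_antimono[OF svd]) simp
      then have "col_sq S j \<noteq> 0" using j' nonneg[of j'] by linarith
      then show ?thesis using j by auto
    qed
    show ?thesis
    proof (cases "pos ` ?D = {}")
      case False
      let ?m = "Max (pos ` ?D)"
      have fin: "finite (pos ` ?D)" by simp
      have "pos ` ?D = {1..?m}"
      proof (intro equalityI subsetI)
        fix k assume k: "k \<in> pos ` ?D"
        then have "1 \<le> k" using pos_bounds(1) by blast
        then show "k \<in> {1..?m}" using Max_ge[OF fin k] by simp
      next
        fix k assume "k \<in> {1..?m}"
        then show "k \<in> pos ` ?D" using down[OF Max_in[OF fin False], of k] by simp
      qed
      then show ?thesis by (metis card_atLeastAtMost diff_Suc_1)
    qed simp
  qed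
  ultimately have "pos ` ?D = {1..rank A}" using rank by simp
  then show ?thesis
    using pos_bounds(1)[of j] inj_image_mem_iff[OF inj_pos, of j ?D] by simp
qed

text \<open>The orthogonal projection onto the span of the first \<open>k\<close> columns of an orthogonal matrix \<open>V\<close>. It depends
  on the right singular vectors only, so two matrices that share these share the projection.\<close>

definition leading_projection :: "real^'n^'n \<Rightarrow> nat \<Rightarrow> real^'n^'n" where
  "leading_projection V k = V ** (\<chi> i j. if i = j \<and> pos i \<le> k then 1 else 0) ** transpose V"

lemma truncated_identity_vector:
  "(\<chi> i j. if i = j \<and> pos i \<le> k then 1 else 0) *v a = (\<chi> i. if pos i \<le> k then (a :: real^'n) $ i else 0)"
proof -
  have "(\<Sum>j\<in>UNIV. (if i = j \<and> pos i \<le> k then 1 else 0) * a $ j)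
      = (\<Sum>j\<in>UNIV. if i = j then (if pos i \<le> k then a $ i else 0) else 0)" for i
    by (intro sum.cong) auto
  then show ?thesis by (simp add: matrix_vector_mult_def vec_eq_iff)
qed

lemma truncated_identity_projection:
  "orthogonal_projection (\<chi> i j. if i = j \<and> pos (i :: 'n::finite) \<le> k then 1 else 0)"
  unfolding orthogonal_projection_def
proof
  show "transpose (\<chi> i j. if i = j \<and> pos (i :: 'n) \<le> k then 1 else 0)
      = (\<chi> i j. if i = j \<and> pos i \<le> k then 1 else (0 :: real))"
    by (auto simp: transpose_def vec_eq_iff)
  show "(\<chi> i j. if i = j \<and> pos (i :: 'n) \<le> k then 1 else 0) ** (\<chi> i j. if i = j \<and> pos i \<le> k then 1 else 0)
      = (\<chi> i j. if i = j \<and> pos i \<le> k then 1 else (0 :: real))"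
    unfolding matrix_eq
    by (simp add: matrix_vector_mul_assoc[symmetric] truncated_identity_vector vec_eq_iff)
qed

lemma leading_projection:
  assumes "orthogonal_matrix V"
  shows "orthogonal_projection (leading_projection V k)"
    and "(transpose V *v (leading_projection V k *v a)) $ i = (if pos i \<le> k then (transpose V *v a) $ i else 0)"
proof -
  let ?D = "(\<chi> i j. if i = j \<and> pos (i :: 'a) \<le> k then 1 else 0) :: real^'a^'a"
  have D: "transpose ?D = ?D" "?D ** ?D = ?D"
    using truncated_identity_projection unfolding orthogonal_projection_def by blast+
  have V: "transpose V ** V = mat 1" using assms by (simp add: orthogonal_matrix_def)
  show "orthogonal_projection (leading_projection V k)"
    unfolding orthogonal_projection_def
  proof
    show "transpose (leading_projection V k) = leading_projection V k"
      by (simp add: leading_projection_def matrix_transpose_mul D(1) matrix_mul_assoc)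
    have "leading_projection V k ** leading_projection V k
        = V ** ?D ** (transpose V ** V) ** ?D ** transpose V"
      by (simp add: leading_projection_def matrix_mul_assoc)
    also have "\<dots> = V ** (?D ** ?D) ** transpose V" by (simp add: V matrix_mul_assoc)
    finally show "leading_projection V k ** leading_projection V k = leading_projection V k"
      by (simp add: D(2) leading_projection_def)
  qed
  have "transpose V ** leading_projection V k = (transpose V ** V) ** ?D ** transpose V"
    by (simp add: leading_projection_def matrix_mul_assoc)
  then have "transpose V *v (leading_projection V k *v a) = ?D *v (transpose V *v a)"
    by (simp add: matrix_vector_mul_assoc V del: transpose_matrix_vector)
  then show "(transpose V *v (leading_projection V k *v a)) $ i = (if pos i \<le> k then (transpose V *v a) $ i else 0)"
    by (simp only: truncated_identity_vector) simp
qed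

lemma rank_leading_projection_compl:
  fixes V :: "real^'n^'n"
  assumes V: "orthogonal_matrix V"
  shows "rank (mat 1 - leading_projection V k) \<le> CARD('n) - k"
proof -
  let ?D = "(\<chi> i j. if i = j \<and> pos (i :: 'n) \<le> k then 1 else 0) :: real^'n^'n"
  let ?I = "{i :: 'n. k < pos i}"
  have VV: "V ** transpose V = mat 1" using V by (simp add: orthogonal_matrix_def)
  have "mat 1 - leading_projection V k = V ** (mat 1 - ?D) ** transpose V"
    by (simp add: leading_projection_def matrix_distribs VV)
  then have "rank (mat 1 - leading_projection V k) \<le> rank (mat 1 - ?D)"
    using rank_mul_le_left[of "V ** (mat 1 - ?D)" "transpose V"] rank_mul_le_right[of V "mat 1 - ?D"]
    by simp
  also have "\<dots> \<le> card ?I"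
  proof -
    have "range ((*v) (mat 1 - ?D)) \<subseteq> {x. \<forall>i. i \<notin> ?I \<longrightarrow> x $ i = 0}"
      by (auto simp: matrix_vector_mult_diff_rdistrib truncated_identity_vector)
    then have "rank (mat 1 - ?D) \<le> dim {x :: real^'n. \<forall>i. i \<notin> ?I \<longrightarrow> x $ i = 0}"
      unfolding rank_dim_range by (rule dim_subset)
    also have "\<dots> = card ?I"
      using dim_substandard_cart[of ?I, where 'a = real] by (simp only: dim_vec_eq)
    finally show ?thesis .
  qed
  also have "card ?I = card (pos ` ?I)" by (metis card_image inj_on_subset inj_pos top_greatest)
  also have "\<dots> \<le> card {Suc k..CARD('n)}"
    using pos_bounds(2) by (intro card_mono) auto
  finally show ?thesis by simp
qed

text \<open>The form in which the singular values enter the analysis: on the span of the right singular vectors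
  for nonzero singular values the matrix is bounded below by the smallest of these, and it vanishes on
  the orthogonal complement.\<close>

lemma svd_conditioning:
  fixes A :: "real^'n^'m"
  assumes svd: "is_svd A U S V" and k: "k = rank A" "1 \<le> k"
  shows "A ** leading_projection V k = A"
    and "0 < singular_value A k" "singular_value A k \<le> singular_value A 1"
    and "singular_value A k * norm (leading_projection V k *v a) \<le> norm (A *v a)"
proof -
  note V = svd_orthogonal(2)[OF svd]
  have bounds: "k \<le> CARD('m)" "k \<le> CARD('n)" using rank_bound[of A] k by auto
  obtain i :: 'm and j :: 'n where i: "pos i = k" and j: "pos j = k"
    using ex_pos[of k] bounds k(2) by metis
  obtain i1 :: 'm and j1 :: 'n where i1: "pos i1 = 1" and j1: "pos j1 = 1"
    using ex_pos[of 1] bounds k(2) by (metis le_trans le_refl)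
  have ij: "pos i = pos j" and ij1: "pos i1 = pos j1" using i j i1 j1 by auto
  have \<sigma>: "singular_value A k = S $ i $ j" "singular_value A 1 = S $ i1 $ j1"
    by (rule singular_value_eq[OF svd i j], rule singular_value_eq[OF svd i1 j1])
  have c: "col_sq S j = (singular_value A k)\<^sup>2" by (simp add: \<sigma> col_sq_eq[OF svd ij])
  have "col_sq S j \<noteq> 0" using col_sq_nonzero_iff[OF svd, of j] j k by simp
  then show pos: "0 < singular_value A k"
    using svd_nonneg[OF svd ij] c by (simp add: \<sigma> less_le)
  show "singular_value A k \<le> singular_value A 1"
    unfolding \<sigma> by (rule svd_antimono[OF svd ij1 ij]) (use i i1 k in simp)
  show Ap: "A ** leading_projection V k = A"
    unfolding matrix_eq
  proof
    fix a
    let ?b = "a - leading_projection V k *v a"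
    have "(norm (A *v ?b))\<^sup>2 = 0"
      unfolding norm_svd[OF svd]
    proof (rule sum.neutral, intro ballI)
      fix l
      show "col_sq S l * ((transpose V *v ?b) $ l)\<^sup>2 = 0"
      proof (cases "pos l \<le> k")
        case True
        then have "(transpose V *v ?b) $ l = 0"
          by (simp only: matrix_vector_mult_diff_distrib vector_minus_component leading_projection(2)[OF V]) simp
        then show ?thesis by (simp only:) simp
      next
        case False
        then have "col_sq S l = 0" using col_sq_nonzero_iff[OF svd, of l] k by auto
        then show ?thesis by simp
      qed
    qed
    then show "(A ** leading_projection V k) *v a = A *v a"
      by (simp add: matrix_vector_mult_diff_distrib matrix_vector_mul_assoc)
  qed
  let ?c = "leading_projection V k *v a"
  have "col_sq S j * (norm ?c)\<^sup>2 \<le> (norm (A *v ?c))\<^sup>2"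
    by (rule svd_lower[OF svd]) (simp only: leading_projection(2)[OF V] j, simp)
  then have "(singular_value A k * norm ?c)\<^sup>2 \<le> (norm (A *v ?c))\<^sup>2"
    by (simp add: c power_mult_distrib)
  then have "singular_value A k * norm ?c \<le> norm (A *v ?c)"
    by (rule power2_le_imp_le) simp
  then show "singular_value A k * norm ?c \<le> norm (A *v a)"
    by (simp add: matrix_vector_mul_assoc Ap)
qed

section \<open>Linear convergence\<close>

text \<open>Differences of matrices in the range of \<open>F\<close> have rank at most \<open>2 r\<close>, so \<open>A\<close> determines them.\<close>

lemma factor_problem_minimizers:
  fixes A :: "real^'d2^'d1 \<Rightarrow> real^'m" and Xs :: "real^'r^'d1" and Ys :: "real^'r^'d2"
    and F :: "(real^'r^'d1) \<times> (real^'r^'d2) \<Rightarrow> real^'d2^'d1"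
  assumes F_def: "F = (\<lambda>(U, V). U ** transpose V)"
    and h_def: "h = (\<lambda>Z. (norm (A Z - A (Xs ** transpose Ys)))\<^sup>2)"
    and A: "linear A" and \<alpha>: "0 < \<alpha>"
    and rip: "\<And>Z. rank Z \<le> 6 * CARD('r) \<Longrightarrow> \<alpha> * (norm Z)\<^sup>2 \<le> (norm (A Z))\<^sup>2"
  shows "opt_value h F = 0" and "opt_set h F = {Xs ** transpose Ys}"
proof -
  have zs: "F (Xs, Ys) = Xs ** transpose Ys" by (simp add: F_def)
  then have mem: "Xs ** transpose Ys \<in> range F" by (metis rangeI)
  have h0: "h (Xs ** transpose Ys) = 0" and h_nonneg: "0 \<le> h z" for z by (simp_all add: h_def)
  show "opt_value h F = 0"
    unfolding opt_value_def
    by (rule cInf_eq_minimum) (use mem h0 h_nonneg in \<open>auto intro: rev_image_eqI\<close>)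
  have "z = Xs ** transpose Ys" if z: "z \<in> opt_set h F" for z
  proof -
    obtain x where "z = F x" using z by (auto simp: opt_set_def)
    then have UV: "z = fst x ** transpose (snd x)" by (simp add: F_def case_prod_beta)
    have "h z \<le> h (Xs ** transpose Ys)" using z mem unfolding opt_set_def by blast
    then have "h z \<le> 0" by (simp only: h0)
    then have "A (z - Xs ** transpose Ys) = 0" by (simp add: h_def linear_diff[OF A])
    moreover have "rank (z - Xs ** transpose Ys) \<le> 6 * CARD('r)"
      using rank_diff_le[of z "Xs ** transpose Ys"] rank_mult_inner_dim[of "fst x" "transpose (snd x)"]
        rank_mult_inner_dim[of Xs "transpose Ys"] by (simp add: UV)
    ultimately have "\<alpha> * (norm (z - Xs ** transpose Ys))\<^sup>2 \<le> 0" using rip by fastforce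
    then show ?thesis using \<alpha> by (simp add: mult_le_0_iff)
  qed
  moreover have "Xs ** transpose Ys \<in> opt_set h F"
    using mem h0 h_nonneg by (auto simp: opt_set_def)
  ultimately show "opt_set h F = {Xs ** transpose Ys}" by blast
qed

text \<open>The iterates must not leave the neighbourhood where a step contracts. A step has length of the order
  of \<open>\<gamma>\<close> times the square root of the error, while the contraction of the error shrinks that square root
  by a factor \<open>1 - \<gamma> * \<rho> / 8\<close>. So a suitable multiple of the square root of the error pays for
  all further movement, and the geometric series never has to be summed.\<close>

lemma potential_step:
  assumes \<gamma>: "0 < \<gamma>" "\<gamma> \<le> 1" and \<rho>: "0 < \<rho>" "\<rho> \<le> 1" and c: "0 < c" and \<epsilon>: "0 \<le> \<epsilon>" "0 \<le> \<epsilon>'"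
    and contr: "\<epsilon>'\<^sup>2 \<le> (1 - \<gamma> / 2 * \<rho>) * \<epsilon>\<^sup>2" and move: "\<Delta>\<^sup>2 \<le> \<gamma>\<^sup>2 * \<epsilon> / c"
  shows "\<Delta> + 8 / \<rho> * sqrt (\<epsilon>' / c) \<le> 8 / \<rho> * sqrt (\<epsilon> / c)"
proof -
  define x where "x = \<gamma> * \<rho> / 8"
  have x: "0 \<le> x" "x \<le> 1"
    using \<gamma> \<rho> mult_mono[of \<gamma> 1 \<rho> 1] by (auto simp: x_def)
  have "1 - \<gamma> / 2 * \<rho> \<le> (1 - x) ^ 4"
    using Bernoulli_inequality[of "- x" 4] x by (simp add: x_def)
  then have "\<epsilon>'\<^sup>2 \<le> (1 - x) ^ 4 * \<epsilon>\<^sup>2"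
    using contr by (meson mult_right_mono order_trans zero_le_power2)
  also have "\<dots> = ((1 - x)\<^sup>2 * \<epsilon>)\<^sup>2" by (simp add: power_mult_distrib flip: power_mult)
  finally have "\<epsilon>' \<le> (1 - x)\<^sup>2 * \<epsilon>" by (rule power2_le_imp_le) (use \<epsilon> in simp)
  then have "\<epsilon>' / c \<le> (1 - x)\<^sup>2 * (\<epsilon> / c)" using c by (simp add: field_simps)
  then have "sqrt (\<epsilon>' / c) \<le> sqrt ((1 - x)\<^sup>2 * (\<epsilon> / c))" by (rule real_sqrt_le_mono)
  also have "\<dots> = (1 - x) * sqrt (\<epsilon> / c)" unfolding real_sqrt_mult using x by simp
  finally have y: "8 / \<rho> * sqrt (\<epsilon>' / c) \<le> 8 / \<rho> * ((1 - x) * sqrt (\<epsilon> / c))"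
    using \<rho> by (intro mult_left_mono) auto
  have "\<Delta>\<^sup>2 \<le> (\<gamma> * sqrt (\<epsilon> / c))\<^sup>2" using move \<epsilon> c by (simp add: power_mult_distrib)
  then have "\<Delta> \<le> \<gamma> * sqrt (\<epsilon> / c)"
    by (rule power2_le_imp_le) (use \<gamma> \<epsilon> c in simp)
  moreover have "8 / \<rho> * ((1 - x) * sqrt (\<epsilon> / c)) = 8 / \<rho> * sqrt (\<epsilon> / c) - \<gamma> * sqrt (\<epsilon> / c)"
    using \<rho> by (simp add: x_def field_simps)
  ultimately show ?thesis using y by linarith
qed

theorem corollary5p10:
  fixes Zs :: "real^'d2^'d1"
    and Xs :: "real^'r^'d1" and Ys :: "real^'r^'d2"
    and A :: "real^'d2^'d1 \<Rightarrow> real^'m" and b :: "real^'m"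
    and rs :: nat
    and \<delta> \<gamma> Clb Cub :: real
    and F :: "(real^'r^'d1) \<times> (real^'r^'d2) \<Rightarrow> real^'d2^'d1"
    and h :: "real^'d2^'d1 \<Rightarrow> real"
    and X :: "nat \<Rightarrow> real^'r^'d1" and Y :: "nat \<Rightarrow> real^'r^'d2"
    and gam lam :: "nat \<Rightarrow> real"
  assumes rank_Zs: "rank Zs = rs" "1 \<le> rs" "rs \<le> CARD('r)"
    and A_linear: "linear A"
    and delta: "0 < \<delta>" "\<delta> < 1"
    and rip: "\<And>Z. rank Z \<le> 6 * CARD('r) \<Longrightarrow>
        (1 - \<delta>) * (norm Z)\<^sup>2 \<le> (norm (A Z))\<^sup>2 \<and> (norm (A Z))\<^sup>2 \<le> (1 + \<delta>) * (norm Z)\<^sup>2"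
    and b_def: "b = A Zs"
    and factorization: "Xs ** transpose Ys = Zs" "rank Xs = rs" "rank Ys = rs"
    and right_vectors: "same_right_singular_vectors Xs Ys"
    and F_def: "F = (\<lambda>(U, V). U ** transpose V)"
    and h_def: "h = (\<lambda>Z. (norm (A Z - b))\<^sup>2)"
    and lmm: "lmm_sequence h F gam lam (\<lambda>k. (X k, Y k))"
    and polyak: "polyak_configuration h F \<gamma> Clb Cub gam lam (\<lambda>k. (X k, Y k))"
    and params: "0 < \<gamma>" "0 < Clb" "Clb \<le> Cub"
    and gamma_le: "\<gamma> \<le> min 1 (Clb / sqrt 2)"
    and Cub_le: "Cub \<le> 1 / (2 ^ 9 * 5 * sqrt 2 * (real CARD('r) - real rs + 1)\<^sup>2)
        * ((1 - \<delta>) ^ 4 / (1 + \<delta>) ^ 4)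
        * (min ((singular_value Xs rs)\<^sup>2) ((singular_value Ys rs)\<^sup>2)
           / ((singular_value Xs rs)\<^sup>2 + (singular_value Ys rs)\<^sup>2))"
    and init_dist: "norm ((X 0, Y 0) - (Xs, Ys)) \<le> 1 / (32 * sqrt 2)
        * (min ((singular_value Xs rs)\<^sup>2) ((singular_value Ys rs)\<^sup>2)
           / max (singular_value Xs 1) (singular_value Ys 1))"
    and init_val: "norm (X 0 ** transpose (Y 0) - Zs) \<le> 1 / 2 ^ 23
        * ((1 - \<delta>) ^ 4 / (1 + \<delta>) ^ 4)
        * (min (singular_value Xs rs ^ 4) (singular_value Ys rs ^ 4)
           / min ((singular_value Xs 1)\<^sup>2) ((singular_value Ys 1)\<^sup>2))
        * Clb"
  shows "\<forall>k. (norm (X k ** transpose (Y k) - Zs))\<^sup>2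
    \<le> (1 - \<gamma> / 32 * ((1 - \<delta>)\<^sup>2 / (1 + \<delta>)\<^sup>2)) ^ k
        * (norm (X 0 ** transpose (Y 0) - Zs))\<^sup>2"
proof -
  define r where "r = CARD('r)"
  define \<rho> where "\<rho> = (1 - \<delta>) / (1 + \<delta>)"
  have \<rho>: "0 < \<rho>" "\<rho> \<le> 1" using delta by (auto simp: \<rho>_def)
  have \<rho>4: "(1 - \<delta>) ^ 4 / (1 + \<delta>) ^ 4 = \<rho> ^ 4" by (simp add: \<rho>_def power_divide)
  have \<rho>2: "(1 - \<delta>)\<^sup>2 / (1 + \<delta>)\<^sup>2 = \<rho>\<^sup>2" by (simp add: \<rho>_def power_divide)
  define sX where "sX = singular_value Xs rs"
  define sY where "sY = singular_value Ys rs"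
  define \<mu> where "\<mu> = min sX sY"
  obtain U S U' S' V where svdX: "is_svd Xs U S V" and svdY: "is_svd Ys U' S' V"
    using right_vectors unfolding same_right_singular_vectors_def by blast
  define p where "p = leading_projection V rs"
  note condX = svd_conditioning[OF svdX factorization(2)[symmetric] rank_Zs(2), folded p_def sX_def]
  note condY = svd_conditioning[OF svdY factorization(3)[symmetric] rank_Zs(2), folded p_def sY_def]
  have p: "orthogonal_projection p"
    unfolding p_def by (rule leading_projection(1)[OF svd_orthogonal(2)[OF svdX]])
  have rank_compl: "real (rank (mat 1 - p)) \<le> real r - real rs"
    using rank_leading_projection_compl[OF svd_orthogonal(2)[OF svdX], of rs] rank_Zs(3)
    unfolding p_def r_def by linarith
  have \<mu>: "0 < \<mu>" using condX(2) condY(2) by (simp add: \<mu>_def)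
  have lowerX: "\<mu> * norm (p *v a) \<le> norm (Xs *v a)" for a
  proof -
    have "\<mu> * norm (p *v a) \<le> sX * norm (p *v a)" by (intro mult_right_mono) (auto simp: \<mu>_def)
    then show ?thesis using condX(4)[of a] by linarith
  qed
  have lowerY: "\<mu> * norm (p *v a) \<le> norm (Ys *v a)" for a
  proof -
    have "\<mu> * norm (p *v a) \<le> sY * norm (p *v a)" by (intro mult_right_mono) (auto simp: \<mu>_def)
    then show ?thesis using condY(4)[of a] by linarith
  qed
  have sqrt2: "7 / 5 \<le> sqrt 2" by (rule real_le_rsqrt) (simp add: power2_eq_square)
  have min_pow: "min (sX ^ n) (sY ^ n) = \<mu> ^ n" for n
  proof (cases "sX \<le> sY")
    case True
    then have "sX ^ n \<le> sY ^ n" using condX(2) by (intro power_mono) auto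
    then show ?thesis using True by (simp add: \<mu>_def)
  next
    case False
    then have "sY ^ n \<le> sX ^ n" using condY(2) by (intro power_mono) auto
    then show ?thesis using False by (simp add: \<mu>_def)
  qed
  have top: "\<mu> \<le> singular_value Xs 1" "\<mu> \<le> singular_value Ys 1"
    using condX(3) condY(3) by (auto simp: \<mu>_def)

  (* The damping bound, in terms of the number s of redundant columns; 7168 is 2 * 2^9 * 5 * (7/5). *)
  have Cub: "0 < Cub" using params by linarith
  define s where "s = real r - real rs"
  have s0: "0 \<le> s" using rank_Zs(3) by (simp add: s_def r_def)
  have Cub_s: "Cub \<le> \<rho> ^ 4 / (7168 * (s + 1)\<^sup>2)"
  proof -
    have "2 * \<mu>\<^sup>2 \<le> sX\<^sup>2 + sY\<^sup>2"
      using min_pow[of 2] by linarith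
    moreover have "0 < sX\<^sup>2 + sY\<^sup>2" using condX(2) by (simp add: add_pos_nonneg)
    ultimately have half: "\<mu>\<^sup>2 / (sX\<^sup>2 + sY\<^sup>2) \<le> 1 / 2" by (simp add: field_simps)
    have "1 / (2 ^ 9 * 5 * sqrt 2 * (s + 1)\<^sup>2) \<le> 1 / (3584 * (s + 1)\<^sup>2)"
      using sqrt2 s0 by (intro divide_left_mono mult_right_mono mult_pos_pos) auto
    then have "1 / (2 ^ 9 * 5 * sqrt 2 * (s + 1)\<^sup>2) * \<rho> ^ 4 * (\<mu>\<^sup>2 / (sX\<^sup>2 + sY\<^sup>2))
        \<le> 1 / (3584 * (s + 1)\<^sup>2) * \<rho> ^ 4 * (1 / 2)"
      using half \<rho> s0 by (intro mult_mono) auto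
    then show ?thesis
      using Cub_le unfolding \<rho>4 sX_def[symmetric] sY_def[symmetric] min_pow r_def[symmetric] s_def[symmetric]
      by simp
  qed
  have \<rho>_pow: "\<rho> ^ n \<le> 1" for n using \<rho> by (simp add: power_le_one)
  have Cub_rank: "Cub * (100 * (real (rank (mat 1 - p)) + 1)) \<le> \<rho>\<^sup>2 / 70"
  proof -
    have "Cub * (100 * (real (rank (mat 1 - p)) + 1)) \<le> \<rho> ^ 4 / (7168 * (s + 1)\<^sup>2) * (100 * (s + 1))"
      using Cub_s Cub rank_compl s0 by (intro mult_mono) (auto simp: s_def)
    also have "\<dots> = \<rho> ^ 4 * (100 / 7168) / (s + 1)"
    proof -
      have "a / (7168 * u\<^sup>2) * (100 * u) = a * (100 / 7168) / u" if "u \<noteq> 0" for a u :: real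
        using that by (simp add: power2_eq_square)
      then show ?thesis by this (use s0 in simp)
    qed
    also have "\<dots> \<le> \<rho> ^ 4 * (100 / 7168) / 1" using s0 \<rho> by (intro divide_left_mono) auto
    also have "\<dots> = \<rho>\<^sup>2 * \<rho>\<^sup>2 * (100 / 7168)" by (simp add: power2_eq_square power4_eq_xxxx)
    also have "\<dots> \<le> \<rho>\<^sup>2 * 1 * (1 / 70)" using \<rho>_pow[of 2] by (intro mult_mono) auto
    finally show ?thesis by simp
  qed
  have Clb1: "Clb \<le> 1"
  proof -
    have "Cub * 100 \<le> Cub * (100 * (real (rank (mat 1 - p)) + 1))" using Cub by (intro mult_left_mono) auto
    then show ?thesis using Cub_rank \<rho>_pow[of 2] params by linarith
  qed

  define x where "x k = (X k, Y k)" for k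
  define \<epsilon> where "\<epsilon> k = norm (X k ** transpose (Y k) - Zs)" for k
  have \<epsilon>0: "0 \<le> \<epsilon> k" for k by (simp add: \<epsilon>_def)
  (* As \<mu> is at most the largest singular values, the initial conditions bound both distances in terms of \<mu>. *)
  have init_\<epsilon>: "\<epsilon> 0 \<le> 1 / 2 ^ 23 * \<rho> ^ 4 * \<mu>\<^sup>2 * Clb"
  proof -
    define m where "m = min ((singular_value Xs 1)\<^sup>2) ((singular_value Ys 1)\<^sup>2)"
    have m: "\<mu>\<^sup>2 \<le> m" using top \<mu> by (auto simp: m_def power_mono)
    moreover have "0 < \<mu>\<^sup>2" using \<mu> by simp
    ultimately have "0 < m * \<mu>\<^sup>2" by (intro mult_pos_pos) linarith+
    then have "\<mu> ^ 4 / m \<le> \<mu> ^ 4 / \<mu>\<^sup>2" using m by (intro divide_left_mono) auto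
    then have "\<mu> ^ 4 / m \<le> \<mu>\<^sup>2" using \<mu> by (simp add: power2_eq_square power4_eq_xxxx)
    then have "1 / 2 ^ 23 * \<rho> ^ 4 * (\<mu> ^ 4 / m) * Clb \<le> 1 / 2 ^ 23 * \<rho> ^ 4 * \<mu>\<^sup>2 * Clb"
      using \<rho> params(2) by (intro mult_right_mono mult_left_mono) auto
    then show ?thesis
      using init_val unfolding \<rho>4 \<epsilon>_def sX_def[symmetric] sY_def[symmetric] min_pow m_def[symmetric] by linarith
  qed
  have \<epsilon>_basin: "\<epsilon> 0 \<le> \<rho> / 100 * \<mu>\<^sup>2"
  proof -
    have "1 / 2 ^ 23 * \<rho> ^ 4 * \<mu>\<^sup>2 * Clb = \<rho> * (1 / 2 ^ 23 * \<rho> ^ 3 * Clb) * \<mu>\<^sup>2"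
      by (simp add: power3_eq_cube power4_eq_xxxx)
    also have "\<dots> \<le> \<rho> * (1 / 100) * \<mu>\<^sup>2"
    proof (intro mult_right_mono mult_left_mono)
      have "Clb * \<rho> ^ 3 \<le> 1 * 1" using \<rho>_pow[of 3] Clb1 \<rho> params by (intro mult_mono) auto
      then show "1 / 2 ^ 23 * \<rho> ^ 3 * Clb \<le> 1 / 100" by (simp add: mult.commute)
    qed (use \<rho> in auto)
    also have "\<dots> = \<rho> / 100 * \<mu>\<^sup>2" by simp
    finally show ?thesis using init_\<epsilon> by linarith
  qed
  (* The potential that pays for the movement of the iterates. *)
  define c where "c = 12 * Clb"
  have c: "0 < c" using params by (simp add: c_def)
  define y where "y k = 8 / \<rho> * sqrt (\<epsilon> k / c)" for k
  have y0: "0 \<le> y k" for k using \<rho> \<epsilon>0 c by (simp add: y_def)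
  have init_y: "y 0 \<le> \<mu> / 1000"
  proof (rule power2_le_imp_le)
    have "(y 0)\<^sup>2 = 64 / \<rho>\<^sup>2 * (\<epsilon> 0 / c)" using \<epsilon>0 c by (simp add: y_def power_mult_distrib power_divide)
    also have "\<dots> \<le> 64 / \<rho>\<^sup>2 * (1 / 2 ^ 23 * \<rho> ^ 4 * \<mu>\<^sup>2 * Clb / c)"
      using init_\<epsilon> c by (intro mult_left_mono divide_right_mono) auto
    also have "\<dots> = \<rho>\<^sup>2 * (\<mu>\<^sup>2 * (64 / (12 * 2 ^ 23)))"
      using params(2) \<rho> by (simp add: c_def power2_eq_square power4_eq_xxxx)
    also have "\<dots> \<le> 1 * (\<mu>\<^sup>2 * (1 / 1000000))"
      using \<rho>_pow[of 2] by (intro mult_mono) auto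
    finally show "(y 0)\<^sup>2 \<le> (\<mu> / 1000)\<^sup>2" by (simp add: power_divide)
  qed (use \<mu> in simp)
  have init_x: "norm (x 0 - (Xs, Ys)) \<le> \<mu> / 44"
  proof -
    define m where "m = max (singular_value Xs 1) (singular_value Ys 1)"
    have m: "\<mu> \<le> m" using top by (simp add: m_def)
    then have "\<mu>\<^sup>2 / m \<le> \<mu>\<^sup>2 / \<mu>" using \<mu> by (intro divide_left_mono) auto
    then have "\<mu>\<^sup>2 / m \<le> \<mu>" using \<mu> by (simp add: power2_eq_square)
    moreover have "1 / (32 * sqrt 2) \<le> 1 / (32 * (7 / 5))"
      using sqrt2 by (intro divide_left_mono) auto
    ultimately have "1 / (32 * sqrt 2) * (\<mu>\<^sup>2 / m) \<le> 1 / (32 * (7 / 5)) * \<mu>"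
      using \<mu> m by (intro mult_mono) auto
    moreover have "1 / (32 * (7 / 5)) * \<mu> \<le> \<mu> / 44" using \<mu> by simp
    ultimately show ?thesis
      using init_dist unfolding x_def sX_def[symmetric] sY_def[symmetric] min_pow m_def[symmetric] by linarith
  qed

  have h_eq: "h = (\<lambda>Z. (norm (A Z - A (Xs ** transpose Ys)))\<^sup>2)"
    by (simp add: h_def b_def factorization)
  have \<alpha>: "0 < 1 - \<delta>" and \<alpha>\<beta>: "1 - \<delta> \<le> 1 + \<delta>" using delta by auto
  have opt_v: "opt_value h F = 0" and opt_s: "opt_set h F = {Zs}"
    using factor_problem_minimizers[OF F_def h_eq A_linear \<alpha>] rip by (simp_all add: factorization)
  have \<gamma>: "0 < \<gamma>" "\<gamma> \<le> 1" "\<gamma> \<le> Clb / sqrt 2" using params gamma_le by auto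
  have Fx: "F (x k) = X k ** transpose (Y k)" for k by (simp add: F_def x_def)
  define q where "q = 1 - \<gamma> / 2 * \<rho>"
  have q: "0 \<le> q" "q \<le> 1" using \<gamma> \<rho> mult_mono[of \<gamma> 1 \<rho> 1] by (auto simp: q_def)
  have step: "(\<epsilon> (Suc k))\<^sup>2 \<le> q * (\<epsilon> k)\<^sup>2 \<and> norm (x (Suc k) - x k) + y (Suc k) \<le> y k"
    if near: "norm (x k - (Xs, Ys)) \<le> \<mu> / 40" and small: "\<epsilon> k \<le> \<rho> / 100 * \<mu>\<^sup>2" for k
  proof (cases "F (x k) = Zs")
    case True
    then have "x (Suc k) = x k" using lmm opt_s unfolding lmm_sequence_def x_def by (auto split: if_splits)
    then have "\<epsilon> (Suc k) = 0" "\<epsilon> k = 0" using True Fx[of k] by (auto simp: \<epsilon>_def x_def)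
    then show ?thesis using \<open>x (Suc k) = x k\<close> by (simp add: y_def)
  next
    case False
    then have lm: "0 < gam k" "x (Suc k) = lmm_step h F (gam k) (lam k) (X k, Y k)"
      using lmm opt_s unfolding lmm_sequence_def x_def by (auto split: if_splits)
    define e where "e = X k ** transpose (Y k) - Xs ** transpose Ys"
    have \<epsilon>e: "\<epsilon> k = norm e" by (simp add: \<epsilon>_def e_def factorization)
    have e0: "e \<noteq> 0" using False Fx by (simp add: e_def factorization)
    have "infdist (F (x k)) (opt_set h F) = norm e"
      by (simp add: opt_s infdist_singleton dist_norm Fx e_def factorization)
    then have pol: "gam k = \<gamma> * (h (F (X k, Y k)) /
        (norm (range_projection F (X k, Y k) (gradient h (F (X k, Y k)))))\<^sup>2)"
      "Clb * norm e \<le> lam k" "lam k \<le> Cub * norm e"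
      using polyak[unfolded polyak_configuration_def, rule_format, of k] opt_v by (simp_all add: x_def)
    have "norm (X k - Xs) \<le> norm (x k - (Xs, Ys))" "norm (Y k - Ys) \<le> norm (x k - (Xs, Ys))"
      using norm_fst_le[of "X k - Xs" "Y k - Ys"] norm_snd_le[of "Y k - Ys" "X k - Xs"]
      by (simp_all add: x_def)
    then have close: "norm (X k - Xs) \<le> \<mu> / 40" "norm (Y k - Ys) \<le> \<mu> / 40" using near by linarith+
    note contr = lmm_step_contracts[OF F_def h_eq p condX(1) condY(1) \<mu> lowerX lowerY close A_linear
        \<alpha> \<alpha>\<beta> \<rho>_def rip e_def e0 small[unfolded \<epsilon>e] \<gamma> params(2) pol(2,3) Cub_rank lm(1) pol(1)]
    have 1: "(\<epsilon> (Suc k))\<^sup>2 \<le> (1 - \<gamma> / 2 * \<rho>) * (\<epsilon> k)\<^sup>2"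
      using contr(1) by (simp add: lm(2)[symmetric] Fx \<epsilon>_def e_def factorization)
    have 2: "(norm (x (Suc k) - x k))\<^sup>2 \<le> \<gamma>\<^sup>2 * \<epsilon> k / c"
      using contr(2) by (simp add: lm(2)[symmetric] \<epsilon>e c_def) (simp add: x_def)
    show ?thesis
      using 1 potential_step[OF \<gamma>(1,2) \<rho> c \<epsilon>0 \<epsilon>0 1 2] by (simp add: q_def y_def)
  qed
  (* The induction starts because 1/44 + 1/1000 is below 1/40. *)
  have inv: "norm (x k - (Xs, Ys)) + y k \<le> \<mu> / 40 \<and> (\<epsilon> k)\<^sup>2 \<le> q ^ k * (\<epsilon> 0)\<^sup>2" for k
  proof (induction k)
    case 0
    show ?case using init_x init_y \<mu> by simp
  next
    case (Suc k)
    have near: "norm (x k - (Xs, Ys)) \<le> \<mu> / 40" using Suc y0[of k] by linarith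
    have "q ^ k * (\<epsilon> 0)\<^sup>2 \<le> 1 * (\<epsilon> 0)\<^sup>2"
      using q by (intro mult_right_mono power_le_one) auto
    then have "(\<epsilon> k)\<^sup>2 \<le> (\<epsilon> 0)\<^sup>2" using Suc by simp
    then have "\<epsilon> k \<le> \<epsilon> 0" by (rule power2_le_imp_le[OF _ \<epsilon>0])
    then have small: "\<epsilon> k \<le> \<rho> / 100 * \<mu>\<^sup>2" using \<epsilon>_basin by linarith
    note st = step[OF near small]
    have "norm (x (Suc k) - (Xs, Ys)) \<le> norm (x (Suc k) - x k) + norm (x k - (Xs, Ys))"
      using dist_triangle[of "x (Suc k)" "(Xs, Ys)" "x k"] unfolding dist_norm .
    moreover have "q * (\<epsilon> k)\<^sup>2 \<le> q * (q ^ k * (\<epsilon> 0)\<^sup>2)" using Suc q by (intro mult_left_mono) auto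
    ultimately show ?case using st Suc by (simp add: mult.assoc)
  qed
  show ?thesis
  proof
    fix k
    have "\<gamma> / 32 * \<rho>\<^sup>2 \<le> \<gamma> / 2 * \<rho>"
      using \<gamma> \<rho> by (intro mult_mono) (auto simp: power2_eq_square mult_left_le)
    then have "q ^ k \<le> (1 - \<gamma> / 32 * \<rho>\<^sup>2) ^ k" using q by (intro power_mono) (auto simp: q_def)
    then have "q ^ k * (\<epsilon> 0)\<^sup>2 \<le> (1 - \<gamma> / 32 * \<rho>\<^sup>2) ^ k * (\<epsilon> 0)\<^sup>2" by (intro mult_right_mono) auto
    then show "(norm (X k ** transpose (Y k) - Zs))\<^sup>2
      \<le> (1 - \<gamma> / 32 * ((1 - \<delta>)\<^sup>2 / (1 + \<delta>)\<^sup>2)) ^ k * (norm (X 0 ** transpose (Y 0) - Zs))\<^sup>2"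
      using inv[of k] unfolding \<rho>2 \<epsilon>_def by linarith
  qed
qed

end
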